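(* Let $1\leq\xi<\omega_1$. Then there exists a partial injection $i:\omega^\omega\rightarrow\omega^\omega$ whose domain and range are disjoint, whose graph $\mathrm{Gr}(i)$ is the difference of two closed subsets of $\omega^\omega\times\omega^\omega$, and such that $\mathrm{Gr}(i)$ has no ${\bf\Delta}^0_\xi$-measurable countable coloring, i.e. there is no ${\bf\Delta}^0_\xi$-measurable map $c:\omega^\omega\rightarrow\omega$ with $c(x)\neq c(y)$ for all $(x,y)\in\mathrm{Gr}(i)$.
   Context: $\omega^\omega$ carries the usual product topology. A map $c:\omega^\omega\to\omega$ is ${\bf\Delta}^0_\xi$-measurable if $c^{-1}(\{n\})\in{\bf\Delta}^0_\xi(\omega^\omega)$ for every $n\in\omega$. *)

theory Defs
  imports "HOL-Analysis.Analysis" "HOL-Library.Countable_Set_Type"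
begin

text \<open>
  The countable ordinals, i.e. the elements of the ordinal \<open>\<omega>\<^sub>1\<close>: the field of the successor cardinal of
  \<open>\<aleph>\<^sub>0\<close>, which in the library is a well-order on a set of sets of natural numbers. The order on the
  type is the one of that well-order; it has nothing to do with inclusion of sets.
\<close>

typedef countable_ordinal = "Field (cardSuc natLeq)"
  morphisms ord_rep ord_abs
  using cardSuc_finite natLeq_Card_order
  by (metis Field_natLeq ex_in_conv finite.emptyI infinite_UNIV_nat)

lemma Well_order_cardSuc_natLeq: "Well_order (cardSuc natLeq)"
  using cardSuc_Card_order[OF natLeq_Card_order] by (simp add: card_order_on_def)

instantiation countable_ordinal :: wellorder
begin

definition less_eq_countable_ordinal_def:
  "(\<eta> :: countable_ordinal) \<le> \<xi> \<longleftrightarrow> (ord_rep \<eta>, ord_rep \<xi>) \<in> cardSuc natLeq"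

definition less_countable_ordinal_def:
  "(\<eta> :: countable_ordinal) < \<xi> \<longleftrightarrow> \<eta> \<le> \<xi> \<and> \<eta> \<noteq> \<xi>"

instance
proof
  have refl: "refl_on (Field (cardSuc natLeq)) (cardSuc natLeq)"
    and trans: "trans (cardSuc natLeq)" and anti: "antisym (cardSuc natLeq)"
    and total: "total_on (Field (cardSuc natLeq)) (cardSuc natLeq)"
    and wf: "wf (cardSuc natLeq - Id)"
    using Well_order_cardSuc_natLeq
    by (auto simp: well_order_on_def linear_order_on_def partial_order_on_def preorder_on_def)
  fix x y z :: countable_ordinal
  show le_refl: "x \<le> x"
    using refl ord_rep[of x] by (auto simp: less_eq_countable_ordinal_def refl_on_def)
  show "x \<le> z" if "x \<le> y" "y \<le> z"
    using that trans by (auto simp: less_eq_countable_ordinal_def trans_def)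
  show le_antisym: "x = y" if "x \<le> y" "y \<le> x"
    using that antisymD[OF anti] by (simp add: less_eq_countable_ordinal_def flip: ord_rep_inject)
  show "(x < y) = (x \<le> y \<and> \<not> y \<le> x)"
    using le_antisym le_refl by (auto simp: less_countable_ordinal_def)
  show "x \<le> y \<or> y \<le> x"
    using total le_refl ord_rep[of x] ord_rep[of y]
    by (cases "x = y") (auto simp: less_eq_countable_ordinal_def total_on_def ord_rep_inject)
  fix P :: "countable_ordinal \<Rightarrow> bool" and a
  assume step: "\<And>x. (\<And>y. y < x \<Longrightarrow> P y) \<Longrightarrow> P x"
  have "wf {(x, y :: countable_ordinal). x < y}"
    by (rule wf_subset[OF wf_inv_image[OF wf, of ord_rep]])
      (auto simp: less_countable_ordinal_def less_eq_countable_ordinal_def ord_rep_inject)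
  then show "P a"
    by (induction a rule: wf_induct_rule) (use step in auto)
qed

end

lemma countable_lessThan_countable_ordinal:
  includes cardinal_syntax
  shows "countable {..<\<xi> :: countable_ordinal}"
proof -
  have "|underS (cardSuc natLeq) (ord_rep \<xi>)| <o cardSuc natLeq"
    by (rule card_of_underS[OF cardSuc_Card_order[OF natLeq_Card_order] ord_rep])
  then have "|underS (cardSuc natLeq) (ord_rep \<xi>)| \<le>o natLeq"
    by (simp add: cardSuc_ordLeq_ordLess natLeq_Card_order card_of_Card_order)
  then have "countable (underS (cardSuc natLeq) (ord_rep \<xi>))"
    by (simp add: countable_card_le_natLeq)
  moreover have "ord_rep ` {..<\<xi>} \<subseteq> underS (cardSuc natLeq) (ord_rep \<xi>)"
    by (auto simp: less_countable_ordinal_def less_eq_countable_ordinal_def underS_def ord_rep_inject)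
  ultimately show ?thesis
    by (meson countable_image_inj_on countable_subset inj_onI ord_rep_inject)
qed

lemma uncountable_UNIV_countable_ordinal:
  includes cardinal_syntax
  shows "uncountable (UNIV :: countable_ordinal set)"
proof
  assume "countable (UNIV :: countable_ordinal set)"
  then have "countable (Field (cardSuc natLeq))"
    by (metis countable_image type_definition.Rep_range type_definition_countable_ordinal)
  then have "|Field (cardSuc natLeq)| \<le>o natLeq"
    by (simp add: countable_card_le_natLeq)
  moreover have "|Field (cardSuc natLeq)| =o cardSuc natLeq"
    by (rule card_of_Field_ordIso[OF cardSuc_Card_order[OF natLeq_Card_order]])
  ultimately have "cardSuc natLeq \<le>o natLeq"
    using ordIso_ordLeq_trans ordIso_symmetric by blast
  then show False
    using cardSuc_greater[OF natLeq_Card_order] not_ordLess_ordLeq by blast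
qed

instantiation countable_ordinal :: zero_neq_one
begin

definition zero_countable_ordinal_def:
  "(0 :: countable_ordinal) = (LEAST \<xi>. True)"

definition one_countable_ordinal_def:
  "(1 :: countable_ordinal) = (LEAST \<xi> :: countable_ordinal. 0 < \<xi>)"

instance
proof
  have "\<exists>\<xi>::countable_ordinal. 0 < \<xi>"
  proof (rule ccontr)
    assume "\<not> ?thesis"
    then have "UNIV = {0 :: countable_ordinal}"
      by (auto simp: not_less zero_countable_ordinal_def intro!: antisym Least_le)
    then show False
      using uncountable_UNIV_countable_ordinal by (metis countable_empty countable_insert)
  qed
  then have "(0 :: countable_ordinal) < 1"
    unfolding one_countable_ordinal_def by (rule LeastI_ex)
  then show "(0 :: countable_ordinal) \<noteq> 1" by simp
qed

end

text \<open>
  The additive Borel classes: \<open>boldSigma \<xi> A\<close> says that \<open>A\<close> is \<open>\<^bold>\<Sigma>\<^sup>0\<^sub>\<xi>\<close>, for \<open>1 \<le> \<xi> < \<omega>\<^sub>1\<close>. The sets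
  \<open>\<^bold>\<Sigma>\<^sup>0\<^sub>1\<close> are the open sets, and for \<open>\<xi> > 1\<close> the sets \<open>\<^bold>\<Sigma>\<^sup>0\<^sub>\<xi>\<close> are the unions of sequences of sets, each
  \<open>\<^bold>\<Pi>\<^sup>0\<^sub>\<eta>\<close> for some \<open>1 \<le> \<eta> < \<xi>\<close>. The second rule cannot be applied with \<open>\<xi> \<le> 1\<close>, and the junk class at
  \<open>\<xi> = 0\<close> is empty.
\<close>

inductive boldSigma :: "countable_ordinal \<Rightarrow> 'a::topological_space set \<Rightarrow> bool" where
  "open U \<Longrightarrow> boldSigma 1 U"
| "(\<And>n::nat. 1 \<le> \<eta> n \<and> \<eta> n < \<xi> \<and> boldSigma (\<eta> n) (- A n)) \<Longrightarrow> boldSigma \<xi> (\<Union>n. A n)"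

lemma boldSigma_one_iff: "boldSigma 1 A \<longleftrightarrow> open A"
proof
  show "open A" if "boldSigma 1 A"
    using that by cases (auto simp: not_less[symmetric])
qed (rule boldSigma.intros(1))

lemma boldSigma_iff:
  assumes "1 < \<xi>"
  shows "boldSigma \<xi> S \<longleftrightarrow>
    (\<exists>A. S = (\<Union>n::nat. A n) \<and> (\<forall>n. \<exists>\<eta>. 1 \<le> \<eta> \<and> \<eta> < \<xi> \<and> boldSigma \<eta> (- A n)))"
proof
  assume "boldSigma \<xi> S"
  then show "\<exists>A. S = (\<Union>n::nat. A n) \<and> (\<forall>n. \<exists>\<eta>. 1 \<le> \<eta> \<and> \<eta> < \<xi> \<and> boldSigma \<eta> (- A n))"
    using assms by cases auto
next
  assume "\<exists>A. S = (\<Union>n::nat. A n) \<and> (\<forall>n. \<exists>\<eta>. 1 \<le> \<eta> \<and> \<eta> < \<xi> \<and> boldSigma \<eta> (- A n))"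
  then obtain A \<eta> where S: "S = (\<Union>n::nat. A n)"
    and *: "\<And>n. 1 \<le> \<eta> n \<and> \<eta> n < \<xi> \<and> boldSigma (\<eta> n) (- A n)"
    by metis
  show "boldSigma \<xi> S"
    unfolding S by (rule boldSigma.intros(2)) (rule *)
qed

definition boldPi :: "countable_ordinal \<Rightarrow> 'a::topological_space set \<Rightarrow> bool"
  where "boldPi \<xi> A \<longleftrightarrow> boldSigma \<xi> (- A)"

definition boldDelta :: "countable_ordinal \<Rightarrow> 'a::topological_space set \<Rightarrow> bool"
  where "boldDelta \<xi> A \<longleftrightarrow> boldSigma \<xi> A \<and> boldPi \<xi> A"

definition boldDelta_measurable :: "countable_ordinal \<Rightarrow> ('a::topological_space \<Rightarrow> nat) \<Rightarrow> bool"
  where "boldDelta_measurable \<xi> c \<longleftrightarrow> (\<forall>n. boldDelta \<xi> (c -` {n}))"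

definition countable_coloring :: "('a \<times> 'a) set \<Rightarrow> ('a \<Rightarrow> nat) \<Rightarrow> bool"
  where "countable_coloring G c \<longleftrightarrow> (\<forall>(x, y) \<in> G. c x \<noteq> c y)"

end

theory Submission
  imports Defs
begin

text \<open>
  For suitable continuous maps from a Polish space into \<open>\<omega>\<^sup>\<omega>\<close>, the \<open>\<^bold>\<Pi>\<^sup>0\<^sub>\<xi>\<close> sets with a comeager preimage are
  governed by back-and-forth relations, as in the comparison of well-founded trees by rank. A stream of natural numbers is
  read as a generic labelling of the tree \<open>\<omega>\<^sup><\<^sup>\<omega>\<close> by labels below a given root label, strictly
  decreasing along branches; the view of a labelling only tells which nodes carry the least
  label. Views of generic labellings determine the labels as ranks, but a \<open>\<^bold>\<Pi>\<^sup>0\<^sub>\<xi>\<close> set cannot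
  distinguish root labels beyond \<open>(\<xi>, 1)\<close>.

  The edges join \<open>(view of a with root label \<rho>\<^sub>n, b)\<close> to \<open>(view of b with root label \<rho>'\<^sub>n, a)\<close>, where \<open>n\<close>
  is the first place at which the streams \<open>a\<close> and \<open>b\<close> differ, and where \<open>n\<close> also codes a finite
  sequence that overwrites the beginning of the stream before it is viewed. Each endpoint shows the
  stream that explains the view in the other one, so the graph is closed away from
  \<open>{a = b}\<close>, although neither endpoint alone reveals its own labelling continuously. The root labels
  are distinct, so ranks make the edges a partial injection with disjoint domain and range. Given
  a colouring, Baire category yields a finite condition on which some colour class is
  comeager for root label \<open>(\<xi>, 1)\<close>; choosing \<open>n\<close> large and coding this condition, the back-and-forth
  argument transfers comeagerness to both kinds of endpoints, and a generic pair \<open>(a, b)\<close> gives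
  a monochromatic edge.
\<close>

section \<open>Labelled trees\<close>

text \<open>\<open>Label \<eta> k\<close> plays the ordinal omega times \<eta> plus
  \<open>k\<close>. Passing to a larger first component leaves room for infinitely many labels,
  enough to answer any finite number of back-and-forth moves.\<close>

datatype label = Label countable_ordinal nat

instantiation label :: wellorder
begin

fun less_label :: "label \<Rightarrow> label \<Rightarrow> bool" where
  "Label \<eta> k < Label \<zeta> m \<longleftrightarrow> \<eta> < \<zeta> \<or> \<eta> = \<zeta> \<and> k < m"

definition less_eq_label :: "label \<Rightarrow> label \<Rightarrow> bool" where
  "\<kappa> \<le> \<mu> \<longleftrightarrow> \<kappa> < \<mu> \<or> \<kappa> = (\<mu> :: label)"

instance
proof
  fix x y z :: label
  show "x \<le> x" "x \<le> y \<Longrightarrow> y \<le> z \<Longrightarrow> x \<le> z" "x \<le> y \<Longrightarrow> y \<le> x \<Longrightarrow> x = y" "x \<le> y \<or> y \<le> x"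
    "(x < y) = (x \<le> y \<and> \<not> y \<le> x)"
    by (cases x; cases y; cases z; force simp: less_eq_label_def)+
  fix P :: "label \<Rightarrow> bool" and a
  assume step: "\<And>x. (\<And>y. y < x \<Longrightarrow> P y) \<Longrightarrow> P x"
  have "P (Label \<eta> k)" for \<eta> k
  proof (induction \<eta> arbitrary: k rule: less_induct)
    case (less \<eta>)
    show ?case
    proof (induction k rule: less_induct)
      case (less k)
      show ?case
      proof (rule step)
        fix y assume "y < Label \<eta> k"
        then show "P y"
          using less.IH \<open>\<And>\<zeta> k. \<zeta> < \<eta> \<Longrightarrow> P (Label \<zeta> k)\<close> by (cases y) auto
      qed
    qed
  qed
  then show "P a" by (cases a) simp
qed

end

definition bottom :: label where "bottom = Label 0 0"

lemma zero_le_countable_ordinal [simp]: "(0 :: countable_ordinal) \<le> \<eta>"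
  by (simp add: zero_countable_ordinal_def Least_le)

lemma not_less_bottom [simp]: "\<not> \<kappa> < bottom"
  by (cases \<kappa>) (auto simp: bottom_def not_less)

lemma bottom_less: "\<kappa> \<noteq> bottom \<Longrightarrow> bottom < \<kappa>"
  by (metis neq_iff not_less_bottom)

lemma bottom_less_Label: "bottom < Label \<eta> (Suc k)"
  using zero_le_countable_ordinal[of \<eta>] by (auto simp: bottom_def le_less)

lemma countable_labels_below: "countable {..<\<kappa> :: label}"
proof (cases \<kappa>)
  case (Label \<eta> k)
  have "countable (insert \<eta> {..<\<eta>})"
    by (simp add: countable_lessThan_countable_ordinal)
  then have "countable ((\<lambda>(\<zeta>, m). Label \<zeta> m) ` (insert \<eta> {..<\<eta>} \<times> UNIV))"
    by (intro countable_image countable_SIGMA) auto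
  moreover have "{..<\<kappa>} \<subseteq> (\<lambda>(\<zeta>, m). Label \<zeta> m) ` (insert \<eta> {..<\<eta>} \<times> UNIV)"
  proof
    fix \<mu> assume "\<mu> \<in> {..<\<kappa>}"
    then show "\<mu> \<in> (\<lambda>(\<zeta>, m). Label \<zeta> m) ` (insert \<eta> {..<\<eta>} \<times> UNIV)"
      by (cases \<mu>) (auto simp: Label image_iff)
  qed
  ultimately show ?thesis
    using countable_subset by blast
qed

text \<open>
  The second component is a visible colour without further meaning. It makes the set infinite for
  every label, so that every number is the code of a legal choice whatever the label of the parent
  is, and codes can be recomputed when labels change.
\<close>

definition choices :: "label \<Rightarrow> (label \<times> nat) set" where
  "choices \<kappa> = insert bottom {..<\<kappa>} \<times> UNIV"

lemma countable_choices: "countable (choices \<kappa>)"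
  by (simp add: choices_def countable_labels_below)

lemma infinite_choices: "infinite (choices \<kappa>)"
  by (simp add: choices_def finite_cartesian_product_iff)

lemma choices_nonempty: "choices \<kappa> \<noteq> {}"
  by (simp add: choices_def)

text \<open>
  Node \<open>0\<close> is the root, and the parent of node \<open>Suc k\<close> is node \<open>parent k\<close>. Each node has infinitely
  many children.
\<close>

definition parent :: "nat \<Rightarrow> nat" where "parent k = fst (prod_decode k)"

lemma parent_le: "parent k \<le> k"
  by (metis le_prod_encode_1 parent_def prod.collapse prod_decode_inverse)

lemma parent_less_Suc: "parent k < Suc k"
  by (simp add: parent_le less_Suc_eq_le)

text \<open>Entry \<open>a k\<close> codes the choice made for node \<open>Suc k\<close>, relative
  to the label of its parent. Since \<open>bottom\<close> is always available, even below
  \<open>bottom\<close>, every stream is a legal labelling.\<close>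

function lab :: "label \<Rightarrow> (nat \<Rightarrow> nat) \<Rightarrow> nat \<Rightarrow> label" where
  "lab \<kappa> a 0 = \<kappa>"
| "lab \<kappa> a (Suc k) = fst (from_nat_into (choices (lab \<kappa> a (parent k))) (a k))"
  by pat_completeness auto
termination
  by (relation "Wellfounded.measure (\<lambda>(\<kappa>, a, i). i)") (auto simp: parent_less_Suc)

definition colour :: "label \<Rightarrow> (nat \<Rightarrow> nat) \<Rightarrow> nat \<Rightarrow> nat" where
  "colour \<kappa> a k = snd (from_nat_into (choices (lab \<kappa> a (parent k))) (a k))"

definition view :: "label \<Rightarrow> (nat \<Rightarrow> nat) \<Rightarrow> nat \<Rightarrow> nat" where
  "view \<kappa> a k = to_nat (lab \<kappa> a (Suc k) = bottom, colour \<kappa> a k)"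

lemma lab_Suc_cases: "lab \<kappa> a (Suc k) = bottom \<or> lab \<kappa> a (Suc k) < lab \<kappa> a (parent k)"
  using from_nat_into[OF choices_nonempty, of "lab \<kappa> a (parent k)" "a k"]
  by (auto simp: choices_def)

text \<open>A countably infinite set of choices is enumerated bijectively, so the code can be
  recovered from the chosen pair once the parent's label is known.\<close>

lemma choice_recover:
  "a k = to_nat_on (choices (lab \<kappa> a (parent k))) (lab \<kappa> a (Suc k), colour \<kappa> a k)"
  by (simp add: colour_def countable_choices infinite_choices)

lemma lab_cong:
  assumes "\<And>k. k < n \<Longrightarrow> a k = b k" and "i \<le> n"
  shows "lab \<kappa> a i = lab \<kappa> b i"
  using assms(2)
proof (induction i rule: less_induct)
  case (less i)
  show ?case
  proof (cases i)
    case (Suc k)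
    then have "lab \<kappa> a (parent k) = lab \<kappa> b (parent k)"
      using less parent_le[of k] by (intro less.IH) auto
    then show ?thesis
      using Suc assms(1)[of k] less.prems by simp
  qed simp
qed

lemma colour_cong:
  assumes "\<And>k. k < n \<Longrightarrow> a k = b k" and "i < n"
  shows "colour \<kappa> a i = colour \<kappa> b i"
proof -
  have "lab \<kappa> a (parent i) = lab \<kappa> b (parent i)"
    using assms parent_le[of i] by (intro lab_cong[of n]) auto
  then show ?thesis
    using assms by (simp add: colour_def)
qed

lemma view_cong:
  assumes "\<And>k. k < n \<Longrightarrow> a k = b k" and "i < n"
  shows "view \<kappa> a i = view \<kappa> b i"
  unfolding view_def using lab_cong[of n a b "Suc i"] colour_cong[of n a b i] assms by simp

section \<open>Rich streams and the recovery of labels as ranks\<close>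

definition rich :: "(nat \<Rightarrow> nat) \<Rightarrow> bool" where
  "rich a \<longleftrightarrow> (\<forall>j c m. \<exists>k\<ge>m. parent k = j \<and> a k = c)"

lemma rich_cong:
  assumes "\<And>k. n \<le> k \<Longrightarrow> a k = b k" and "rich a"
  shows "rich b"
  unfolding rich_def
proof (intro allI)
  fix j c m
  obtain k where "k \<ge> max n m" "parent k = j" "a k = c"
    using assms(2) unfolding rich_def by blast
  then show "\<exists>k\<ge>m. parent k = j \<and> b k = c"
    using assms(1)[of k] by auto
qed

lemma rich_child:
  assumes "rich a" and "\<mu> < lab \<kappa> a j"
  shows "\<exists>k. parent k = j \<and> lab \<kappa> a (Suc k) = \<mu>"
proof -
  obtain k where "parent k = j" "a k = to_nat_on (choices (lab \<kappa> a j)) (\<mu>, 0)"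
    using assms(1) unfolding rich_def by blast
  moreover have "(\<mu>, 0) \<in> choices (lab \<kappa> a j)"
    using assms(2) by (simp add: choices_def)
  ultimately show ?thesis
    by (intro exI[of _ k]) (simp add: countable_choices)
qed

lemma view_eq_iff:
  "view \<kappa> a k = view \<mu> b k \<longleftrightarrow>
    (lab \<kappa> a (Suc k) = bottom \<longleftrightarrow> lab \<mu> b (Suc k) = bottom) \<and> colour \<kappa> a k = colour \<mu> b k"
  by (auto simp: view_def)

text \<open>If node \<open>i\<close> had a label above \<rho> in \<open>b\<close>, richness would
  give it a child labelled \<rho> there. In \<open>a\<close> that child has a label below \<rho>,
  and such labels agree on both sides. For \<rho> = \<open>bottom\<close> the view itself decides,
  except at the root, where neither label is \<open>bottom\<close>.\<close>

lemma lab_le_if_view_eq: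
  assumes "rich b" and "view \<kappa> a = view \<mu> b" and "\<kappa> \<noteq> bottom" "\<mu> \<noteq> bottom"
    and below: "\<And>j. lab \<kappa> a j < \<rho> \<Longrightarrow> lab \<mu> b j = lab \<kappa> a j"
    and "lab \<kappa> a i = \<rho>"
  shows "lab \<mu> b i \<le> \<rho>"
proof (rule ccontr)
  assume "\<not> lab \<mu> b i \<le> \<rho>"
  then have *: "\<rho> < lab \<mu> b i" by simp
  show False
  proof (cases "\<rho> = bottom")
    case True
    have "lab \<kappa> a i = bottom \<longleftrightarrow> lab \<mu> b i = bottom"
      using assms(2-4) by (cases i) (auto simp: fun_eq_iff view_eq_iff simp del: lab.simps(2))
    then show False
      using True * assms(6) by simp
  next
    case False
    obtain k where k: "parent k = i" "lab \<mu> b (Suc k) = \<rho>"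
      using rich_child[OF assms(1) *] by blast
    have "lab \<kappa> a (Suc k) < \<rho>"
      using lab_Suc_cases[of \<kappa> a k] k(1) assms(6) bottom_less[OF False] by auto
    then show False
      using below[of "Suc k"] k(2) by simp
  qed
qed

text \<open>Induction on \<rho> shows that the nodes labelled \<rho> are the same in both trees, as
  with ranks of well-founded trees. Equal labels and colours then give equal codes.\<close>

lemma view_inj:
  assumes "rich a" "rich b" and eq: "view \<kappa> a = view \<mu> b" and "\<kappa> \<noteq> bottom" "\<mu> \<noteq> bottom"
  shows "\<kappa> = \<mu> \<and> a = b"
proof -
  have *: "\<forall>i. lab \<kappa> a i = \<rho> \<longleftrightarrow> lab \<mu> b i = \<rho>" for \<rho>
  proof (induction \<rho> rule: less_induct)
    case (less \<rho>)
    have "lab \<mu> b i = \<rho>" if "lab \<kappa> a i = \<rho>" for i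
    proof -
      have "lab \<mu> b i \<le> \<rho>"
        using assms less that by (intro lab_le_if_view_eq[of b \<kappa> a \<mu> \<rho> i]) auto
      moreover have "\<not> lab \<mu> b i < \<rho>"
        using less[of "lab \<mu> b i"] that by (metis less_irrefl)
      ultimately show ?thesis by simp
    qed
    moreover have "lab \<kappa> a i = \<rho>" if "lab \<mu> b i = \<rho>" for i
    proof -
      have "lab \<kappa> a i \<le> \<rho>"
        using assms less that by (intro lab_le_if_view_eq[of a \<mu> b \<kappa> \<rho> i]) auto
      moreover have "\<not> lab \<kappa> a i < \<rho>"
        using less[of "lab \<kappa> a i"] that by (metis less_irrefl)
      ultimately show ?thesis by simp
    qed
    ultimately show ?case by blast
  qed
  then have lab: "lab \<kappa> a i = lab \<mu> b i" for i by metis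
  have "a k = b k" for k
    using choice_recover[of a k \<kappa>] choice_recover[of b k \<mu>] eq
    by (simp add: lab view_eq_iff fun_eq_iff del: lab.simps(2))
  then show ?thesis
    using lab[of 0] by auto
qed

section \<open>Back-and-forth relations between labellings\<close>

text \<open>At level \<eta> labels from \<open>Label \<eta> 1\<close> on are not told apart. The
  first \<open>n\<close> entries fix the labels of the nodes up to and including \<open>n\<close>,
  hence the two different bounds on \<open>i\<close>.\<close>

definition close :: "countable_ordinal \<Rightarrow> label \<Rightarrow> label \<Rightarrow> nat \<Rightarrow> (nat \<Rightarrow> nat) \<Rightarrow> (nat \<Rightarrow> nat) \<Rightarrow> bool" where
  "close \<eta> \<kappa> \<mu> n a b \<longleftrightarrow>
    (\<forall>i\<le>n. lab \<kappa> a i = lab \<mu> b i \<or> Label \<eta> 1 \<le> lab \<kappa> a i \<and> Label \<eta> 1 \<le> lab \<mu> b i) \<and>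
    (\<forall>i<n. view \<kappa> a i = view \<mu> b i)"

lemma close_sym: "close \<eta> \<kappa> \<mu> n a b \<Longrightarrow> close \<eta> \<mu> \<kappa> n b a"
  by (auto simp: close_def)

lemma close_cong:
  assumes "close \<eta> \<kappa> \<mu> n a b" "\<And>k. k < n \<Longrightarrow> a k = a' k" "\<And>k. k < n \<Longrightarrow> b k = b' k"
  shows "close \<eta> \<kappa> \<mu> n a' b'"
  using assms(1) lab_cong[OF assms(2)] lab_cong[OF assms(3)] view_cong[OF assms(2)] view_cong[OF assms(3)]
  unfolding close_def by simp

text \<open>
  Labels at least \<open>Label \<zeta> 1\<close> are replaced by labels \<open>Label \<zeta> (1 + (M - k))\<close> that decrease in the node
  number; this leaves room below every node for the nodes that are still to come.
\<close>

lemma close_extend_aux: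
  assumes "n \<le> m" "m \<le> M"
    and "\<And>i. i \<le> n \<Longrightarrow> lab \<kappa> a i = lab \<mu> b i \<or>
      Label \<zeta> 1 \<le> lab \<kappa> a i \<and> Label \<zeta> (1 + (M - i)) < lab \<mu> b i"
    and "\<And>i. i < n \<Longrightarrow> view \<kappa> a i = view \<mu> b i"
  shows "\<exists>b'. (\<forall>i<n. b' i = b i) \<and>
    (\<forall>i\<le>m. lab \<kappa> a i = lab \<mu> b' i \<or>
      Label \<zeta> 1 \<le> lab \<kappa> a i \<and> Label \<zeta> (1 + (M - i)) < lab \<mu> b' i) \<and>
    (\<forall>i<m. view \<kappa> a i = view \<mu> b' i)"
  using assms(1,2)
proof (induction m rule: dec_induct)
  case base
  then show ?case using assms(3,4) by blast
next
  case (step m)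
  then obtain b' where b': "\<forall>i<n. b' i = b i"
    and lab: "\<forall>i\<le>m. lab \<kappa> a i = lab \<mu> b' i \<or>
      Label \<zeta> 1 \<le> lab \<kappa> a i \<and> Label \<zeta> (1 + (M - i)) < lab \<mu> b' i"
    and view: "\<forall>i<m. view \<kappa> a i = view \<mu> b' i"
    by auto
  let ?j = "parent m"
  define \<tau> where "\<tau> = lab \<kappa> a (Suc m)"
  \<comment> \<open>The label is copied whenever it is legal below the other parent. Otherwise it is
    large, and \<open>1 + (M - m)\<close> is small enough to lie below that parent, yet exceeds the
    bound \<open>1 + (M - Suc m)\<close> to be kept at the new node.\<close>
  define \<tau>' where "\<tau>' = (if lab \<kappa> a ?j = lab \<mu> b' ?j \<or> \<tau> < Label \<zeta> 1 then \<tau> else Label \<zeta> (1 + (M - m)))"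
  have \<tau>: "\<tau> = bottom \<or> \<tau> < lab \<kappa> a ?j"
    using lab_Suc_cases by (simp add: \<tau>_def del: lab.simps(2))
  have j: "?j \<le> m" by (rule parent_le)
  have valid: "\<tau>' = bottom \<or> \<tau>' < lab \<mu> b' ?j"
  proof (cases "lab \<kappa> a ?j = lab \<mu> b' ?j")
    case True
    then show ?thesis using \<tau> by (auto simp: \<tau>'_def)
  next
    case False
    then have *: "Label \<zeta> (1 + (M - ?j)) < lab \<mu> b' ?j"
      using lab j by blast
    have "Label \<zeta> 1 \<le> Label \<zeta> (1 + (M - ?j))" "Label \<zeta> (1 + (M - m)) \<le> Label \<zeta> (1 + (M - ?j))"
      using j by (auto simp: less_eq_label_def)
    then show ?thesis
      using * \<tau>'_def by (auto simp: False)
  qed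
  define b'' where "b'' = b'(m := to_nat_on (choices (lab \<mu> b' ?j)) (\<tau>', colour \<kappa> a m))"
  have same: "\<And>k. k < m \<Longrightarrow> b'' k = b' k" by (simp add: b''_def)
  have lab'': "lab \<mu> b'' i = lab \<mu> b' i" if "i \<le> m" for i
    using lab_cong[OF same that] .
  have "(\<tau>', colour \<kappa> a m) \<in> choices (lab \<mu> b' ?j)"
    using valid by (auto simp: choices_def)
  then have "from_nat_into (choices (lab \<mu> b'' ?j)) (b'' m) = (\<tau>', colour \<kappa> a m)"
    unfolding lab''[OF j] by (simp add: b''_def countable_choices)
  then have new: "lab \<mu> b'' (Suc m) = \<tau>'" "colour \<mu> b'' m = colour \<kappa> a m"
    by (simp_all add: colour_def[of \<mu> b''])
  have new_lab: "lab \<kappa> a (Suc m) = lab \<mu> b'' (Suc m) \<or>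
      Label \<zeta> 1 \<le> lab \<kappa> a (Suc m) \<and> Label \<zeta> (1 + (M - Suc m)) < lab \<mu> b'' (Suc m)"
    using \<open>Suc m \<le> M\<close> unfolding new(1) by (auto simp: \<tau>'_def \<tau>_def simp del: lab.simps(2))
  have "\<tau> = bottom \<longleftrightarrow> \<tau>' = bottom"
    using bottom_less_Label[of \<zeta> 0] bottom_less_Label[of \<zeta> "M - m"] by (auto simp: \<tau>'_def)
  then have "view \<kappa> a m = view \<mu> b'' m"
    using new by (simp add: view_eq_iff \<tau>_def del: lab.simps(2))
  moreover have "view \<mu> b'' i = view \<mu> b' i" if "i < m" for i
    using view_cong[OF same that] .
  ultimately have "\<forall>i<Suc m. view \<kappa> a i = view \<mu> b'' i"
    using view by (simp add: less_Suc_eq)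
  moreover have "\<forall>i<n. b'' i = b i"
    using b' same step.hyps by simp
  ultimately show ?case
    using lab lab'' new_lab by (intro exI[of _ b'']) (auto simp: le_Suc_eq simp del: lab.simps(2))
qed

lemma close_extend:
  assumes "n \<le> m"
    and "\<And>i. i \<le> n \<Longrightarrow> lab \<kappa> a i = lab \<mu> b i \<or>
      Label \<zeta> 1 \<le> lab \<kappa> a i \<and> Label \<zeta> (1 + (m - i)) < lab \<mu> b i"
    and "\<And>i. i < n \<Longrightarrow> view \<kappa> a i = view \<mu> b i"
  shows "\<exists>b'. (\<forall>i<n. b' i = b i) \<and> close \<zeta> \<kappa> \<mu> m a b'"
proof -
  have less: "Label \<zeta> 1 \<le> \<nu>" if "Label \<zeta> (1 + k) < \<nu>" for \<nu> k
    using that by (cases \<nu>) (auto simp: less_eq_label_def)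
  show ?thesis
    using close_extend_aux[OF assms(1) order_refl assms(2,3)] less unfolding close_def by metis
qed

text \<open>All labels \<open>Label \<zeta> k\<close> lie below \<open>Label \<eta> 1\<close>, so
  descending from \<eta> to \<zeta> leaves room for an extension to any finite length
  \<open>m\<close>.\<close>

lemma close_extend_less:
  assumes "close \<eta> \<kappa> \<mu> n a b" "\<zeta> < \<eta>" "n \<le> m"
  shows "\<exists>b'. (\<forall>i<n. b' i = b i) \<and> close \<zeta> \<kappa> \<mu> m a b'"
proof (rule close_extend[OF assms(3)])
  fix i assume "i \<le> n"
  have "Label \<zeta> k < Label \<eta> 1" for k
    using assms(2) by simp
  then show "lab \<kappa> a i = lab \<mu> b i \<or> Label \<zeta> 1 \<le> lab \<kappa> a i \<and> Label \<zeta> (1 + (m - i)) < lab \<mu> b i"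
    using assms(1) \<open>i \<le> n\<close> unfolding close_def by (meson less_imp_le less_le_trans)
qed (use assms(1) in \<open>auto simp: close_def\<close>)

section \<open>Baire category\<close>

definition meager :: "'a::topological_space set \<Rightarrow> bool" where
  "meager S \<longleftrightarrow> (\<exists>\<T>. countable \<T> \<and> (\<forall>T\<in>\<T>. closed T \<and> interior T = {}) \<and> S \<subseteq> \<Union>\<T>)"

lemma meager_subset:
  assumes "meager T" "S \<subseteq> T"
  shows "meager S"
proof -
  obtain \<T> where "countable \<T>" "\<forall>T\<in>\<T>. closed T \<and> interior T = {}" "T \<subseteq> \<Union>\<T>"
    using assms(1) unfolding meager_def by (elim exE conjE)
  then show ?thesis
    unfolding meager_def using assms(2) by (intro exI[of _ \<T>] conjI) simp_all
qed

lemma meager_nowhere_dense: "closed T \<Longrightarrow> interior T = {} \<Longrightarrow> meager T"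
  unfolding meager_def by (intro exI[of _ "{T}"]) simp

lemma meager_UN:
  assumes "countable I" and "\<And>i. i \<in> I \<Longrightarrow> meager (S i)"
  shows "meager (\<Union>i\<in>I. S i)"
proof -
  have "\<forall>i\<in>I. \<exists>\<T>. countable \<T> \<and> (\<forall>T\<in>\<T>. closed T \<and> interior T = {}) \<and> S i \<subseteq> \<Union>\<T>"
    using assms(2) by (simp add: meager_def)
  from bchoice[OF this] obtain \<T>
    where \<T>: "\<forall>i\<in>I. countable (\<T> i) \<and> (\<forall>T\<in>\<T> i. closed T \<and> interior T = {}) \<and> S i \<subseteq> \<Union>(\<T> i)" ..
  have "countable (\<Union>i\<in>I. \<T> i)"
    using assms(1) \<T> by blast
  moreover have "\<forall>T\<in>(\<Union>i\<in>I. \<T> i). closed T \<and> interior T = {}"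
    using \<T> by blast
  moreover have "(\<Union>i\<in>I. S i) \<subseteq> \<Union>(\<Union>i\<in>I. \<T> i)"
  proof
    fix x assume "x \<in> (\<Union>i\<in>I. S i)"
    then obtain i where i: "i \<in> I" "x \<in> S i" by blast
    have "S i \<subseteq> \<Union>(\<T> i)"
      using bspec[OF \<T> i(1)] by (elim conjE)
    then show "x \<in> \<Union>(\<Union>i\<in>I. \<T> i)"
      using i by blast
  qed
  ultimately show ?thesis
    unfolding meager_def by (intro exI[of _ "\<Union>i\<in>I. \<T> i"] conjI)
qed

lemma meager_Un: "meager S \<Longrightarrow> meager T \<Longrightarrow> meager (S \<union> T)"
  using meager_UN[of "{S, T}" "\<lambda>X. X"] by fastforce

text \<open>If the preimage of a closed nowhere dense set contained a nonempty open set, the image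
  of that open set would have interior points inside the nowhere dense set.\<close>

lemma meager_vimage:
  assumes "continuous_on UNIV f" and "\<And>U. open U \<Longrightarrow> U \<noteq> {} \<Longrightarrow> interior (f ` U) \<noteq> {}" and "meager S"
  shows "meager (f -` S)"
proof -
  obtain \<T> where \<T>: "countable \<T>" "\<forall>T\<in>\<T>. closed T \<and> interior T = {}" "S \<subseteq> \<Union>\<T>"
    using assms(3) unfolding meager_def by (elim exE conjE)
  have "closed (f -` T) \<and> interior (f -` T) = {}" if "T \<in> \<T>" for T
  proof
    show "closed (f -` T)"
      using assms(1) \<T>(2) that by (simp add: closed_vimage)
    show "interior (f -` T) = {}"
    proof (rule ccontr)
      assume "interior (f -` T) \<noteq> {}"
      then have "interior (f ` interior (f -` T)) \<noteq> {}"
        by (intro assms(2)) auto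
      moreover have "f ` interior (f -` T) \<subseteq> T"
        using interior_subset by blast
      ultimately show False
        using \<T>(2) that interior_mono[of "f ` interior (f -` T)" T] by auto
    qed
  qed
  moreover have "f -` S \<subseteq> \<Union>((-`) f ` \<T>)"
    using \<T>(3) by auto
  ultimately show ?thesis
    unfolding meager_def using \<T>(1) by (intro exI[of _ "(-`) f ` \<T>"]) simp
qed

text \<open>A form of the Banach category theorem: countably many basic sets on which
  \<open>S\<close> is meager cover a dense part of \<open>U\<close>, and what they miss is nowhere
  dense.\<close>

lemma meager_localize:
  fixes S :: "'a::second_countable_topology set"
  assumes "open U"
    and "\<And>V. open V \<Longrightarrow> V \<noteq> {} \<Longrightarrow> V \<subseteq> U \<Longrightarrow> \<exists>W. open W \<and> W \<noteq> {} \<and> W \<subseteq> V \<and> meager (W \<inter> S)"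
  shows "meager (U \<inter> S)"
proof -
  obtain B :: "'a set set" where B: "countable B" "topological_basis B"
    using ex_countable_basis by blast
  define \<W> where "\<W> = {W \<in> B. meager (W \<inter> S)}"
  have "open (\<Union>\<W>)"
    using B(2) topological_basis_open unfolding \<W>_def by blast
  have "meager (\<Union>W\<in>\<W>. W \<inter> S)"
    using B(1) by (intro meager_UN) (auto simp: \<W>_def)
  moreover have "meager (closure U - \<Union>\<W>)"
  proof (rule meager_nowhere_dense)
    show "closed (closure U - \<Union>\<W>)"
      using \<open>open (\<Union>\<W>)\<close> by blast
    show "interior (closure U - \<Union>\<W>) = {}"
    proof (rule ccontr)
      let ?V = "interior (closure U - \<Union>\<W>)"
      assume "?V \<noteq> {}"
      moreover have "?V \<subseteq> closure U"
        using interior_subset by blast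
      ultimately have "?V \<inter> U \<noteq> {}"
        using open_Int_closure_eq_empty[OF open_interior] by blast
      then obtain W where W: "open W" "W \<noteq> {}" "W \<subseteq> ?V \<inter> U" "meager (W \<inter> S)"
        using assms(2)[of "?V \<inter> U"] assms(1) by blast
      then obtain w where "w \<in> W" by blast
      then obtain W' where "W' \<in> B" "w \<in> W'" "W' \<subseteq> W"
        using topological_basisE[OF B(2) W(1)] by blast
      moreover from this have "W' \<in> \<W>"
        using meager_subset[OF W(4), of "W' \<inter> S"] unfolding \<W>_def by blast
      moreover have "W \<subseteq> closure U - \<Union>\<W>"
        using W(3) interior_subset by blast
      ultimately show False by blast
    qed
  qed
  ultimately have "meager ((\<Union>W\<in>\<W>. W \<inter> S) \<union> (closure U - \<Union>\<W>))"
    by (rule meager_Un)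
  then show ?thesis
    by (rule meager_subset) (use closure_subset in blast)
qed

section \<open>The Baire property\<close>

text \<open>The property is put as a density statement: below every nonempty open set some nonempty
  open set decides \<open>S\<close> up to a meager set. This form is symmetric under
  complements.\<close>

definition baire_property :: "'a::topological_space set \<Rightarrow> bool" where
  "baire_property S \<longleftrightarrow> (\<forall>U. open U \<and> U \<noteq> {} \<longrightarrow>
    (\<exists>V. open V \<and> V \<noteq> {} \<and> V \<subseteq> U \<and> (meager (V \<inter> S) \<or> meager (V - S))))"

lemma baire_property_Compl: "baire_property S \<Longrightarrow> baire_property (- S)"
  unfolding baire_property_def by (simp add: Diff_eq disj_commute)

text \<open>Either some \<open>S n\<close> is comeager on an open part of \<open>U\<close>, and so
  is the union, or every \<open>S n\<close> is meager in \<open>U\<close> by localization.\<close>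

lemma baire_property_UN:
  fixes S :: "nat \<Rightarrow> 'a::second_countable_topology set"
  assumes "\<And>n. baire_property (S n)"
  shows "baire_property (\<Union>n. S n)"
  unfolding baire_property_def
proof (intro allI impI)
  fix U :: "'a set" assume U: "open U \<and> U \<noteq> {}"
  show "\<exists>V. open V \<and> V \<noteq> {} \<and> V \<subseteq> U \<and> (meager (V \<inter> (\<Union>n. S n)) \<or> meager (V - (\<Union>n. S n)))"
  proof (cases "\<exists>V n. open V \<and> V \<noteq> {} \<and> V \<subseteq> U \<and> meager (V - S n)")
    case True
    then obtain V n where V: "open V" "V \<noteq> {}" "V \<subseteq> U" "meager (V - S n)" by blast
    have "meager (V - (\<Union>n. S n))"
      using V(4) by (rule meager_subset) auto
    with V show ?thesis by (intro exI[of _ V]) simp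
  next
    case False
    have "meager (U \<inter> S n)" for n
    proof (rule meager_localize)
      fix V assume V: "open V" "V \<noteq> {}" "V \<subseteq> U"
      then obtain W where W: "open W" "W \<noteq> {}" "W \<subseteq> V" "meager (W \<inter> S n) \<or> meager (W - S n)"
        using assms[of n] unfolding baire_property_def by (elim allE[of _ V]) auto
      moreover have "\<not> meager (W - S n)"
        using False W(1-3) V(3) by (metis order_trans)
      ultimately show "\<exists>W. open W \<and> W \<noteq> {} \<and> W \<subseteq> V \<and> meager (W \<inter> S n)"
        by (intro exI[of _ W]) simp
    qed (use U in simp)
    then have "meager (\<Union>n. U \<inter> S n)"
      by (intro meager_UN) auto
    then have "meager (U \<inter> (\<Union>n. S n))"
      by simp
    with U show ?thesis by (intro exI[of _ U]) simp
  qed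
qed

lemma baire_property_nonmeager:
  fixes S :: "'a::second_countable_topology set"
  assumes "baire_property S" "open U" "\<not> meager (U \<inter> S)"
  shows "\<exists>V. open V \<and> V \<noteq> {} \<and> V \<subseteq> U \<and> meager (V - S)"
proof (rule ccontr)
  assume *: "\<nexists>V. open V \<and> V \<noteq> {} \<and> V \<subseteq> U \<and> meager (V - S)"
  have "meager (U \<inter> S)"
  proof (rule meager_localize[OF assms(2)])
    fix V assume V: "open V" "V \<noteq> {}" "V \<subseteq> U"
    then obtain W where W: "open W" "W \<noteq> {}" "W \<subseteq> V" "meager (W \<inter> S) \<or> meager (W - S)"
      using assms(1) unfolding baire_property_def by (elim allE[of _ V]) auto
    moreover have "\<not> meager (W - S)"
      using * W(1-3) V(3) by (metis order_trans)
    ultimately show "\<exists>W. open W \<and> W \<noteq> {} \<and> W \<subseteq> V \<and> meager (W \<inter> S)"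
      by (intro exI[of _ W]) simp
  qed
  then show False using assms(3) by simp
qed

section \<open>Cylinders and the Baire category theorem for pairs of sequences\<close>

definition cylinder :: "(nat \<Rightarrow> 'a) \<Rightarrow> nat \<Rightarrow> (nat \<Rightarrow> 'a) set" where
  "cylinder a n = {x. \<forall>i<n. x i = a i}"

lemma cylinder_self [simp]: "a \<in> cylinder a n"
  by (simp add: cylinder_def)

lemma cylinder_mono: "n \<le> m \<Longrightarrow> cylinder a m \<subseteq> cylinder a n"
  by (auto simp: cylinder_def)

lemma cylinder_subset: "n \<le> m \<Longrightarrow> b \<in> cylinder a n \<Longrightarrow> cylinder b m \<subseteq> cylinder a n"
  by (auto simp: cylinder_def)

lemma open_cylinder: "open (cylinder (a :: nat \<Rightarrow> 'a::discrete_topology) n)"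
proof -
  have "cylinder a n = (\<Inter>i\<in>{..<n}. (\<lambda>x. x i) -` {a i})"
    by (auto simp: cylinder_def)
  moreover have "open ((\<lambda>x::nat \<Rightarrow> 'a. x i) -` {a i})" for i
    by (intro open_vimage) (auto simp: open_discrete)
  ultimately show ?thesis by auto
qed

lemma cylinder_basis:
  fixes a :: "nat \<Rightarrow> 'a::discrete_topology"
  assumes "open U" "a \<in> U"
  shows "\<exists>n. cylinder a n \<subseteq> U"
proof -
  obtain X where X: "a \<in> (\<Pi>\<^sub>E i\<in>UNIV. X i)" "\<And>i. open (X i)" "finite {i. X i \<noteq> UNIV}" "(\<Pi>\<^sub>E i\<in>UNIV. X i) \<subseteq> U"
    using product_topology_open_contains_basis[of "\<lambda>_. euclidean" UNIV U a] assms
    unfolding open_fun_def by auto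
  obtain n where n: "\<And>i. X i \<noteq> UNIV \<Longrightarrow> i < n"
    using X(3) finite_nat_set_iff_bounded by auto
  have "cylinder a n \<subseteq> (\<Pi>\<^sub>E i\<in>UNIV. X i)"
  proof
    fix x assume x: "x \<in> cylinder a n"
    have "x i \<in> X i" for i
      using x n[of i] X(1) by (cases "X i = UNIV") (auto simp: cylinder_def PiE_iff)
    then show "x \<in> (\<Pi>\<^sub>E i\<in>UNIV. X i)" by auto
  qed
  then show ?thesis using X(4) by blast
qed

definition brick :: "(nat \<Rightarrow> 'a) \<times> (nat \<Rightarrow> 'b) \<Rightarrow> nat \<Rightarrow> ((nat \<Rightarrow> 'a) \<times> (nat \<Rightarrow> 'b)) set" where
  "brick p n = cylinder (fst p) n \<times> cylinder (snd p) n"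

lemma brick_self [simp]: "p \<in> brick p n"
  by (simp add: brick_def mem_Times_iff)

lemma brick_mono: "n \<le> m \<Longrightarrow> brick p m \<subseteq> brick p n"
  by (auto simp: brick_def cylinder_def)

lemma open_brick: "open (brick (p :: (nat \<Rightarrow> 'a::discrete_topology) \<times> (nat \<Rightarrow> 'b::discrete_topology)) n)"
  by (simp add: brick_def open_Times open_cylinder)

lemma brick_basis:
  fixes p :: "(nat \<Rightarrow> 'a::discrete_topology) \<times> (nat \<Rightarrow> 'b::discrete_topology)"
  assumes "open U" "p \<in> U"
  shows "\<exists>n\<ge>k. brick p n \<subseteq> U"
proof -
  obtain A B where AB: "open A" "open B" "p \<in> A \<times> B" "A \<times> B \<subseteq> U"
    using open_prod_elim[OF assms] by metis
  obtain n m where "cylinder (fst p) n \<subseteq> A" "cylinder (snd p) m \<subseteq> B"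
    using cylinder_basis AB by (metis mem_Times_iff)
  then have "brick p (max k (max n m)) \<subseteq> U"
    using AB(4) cylinder_mono[of n "max k (max n m)" "fst p"] cylinder_mono[of m "max k (max n m)" "snd p"]
    unfolding brick_def by fastforce
  then show ?thesis by (meson max.cobounded1)
qed
theorem baire_sequences:
  fixes U :: "((nat \<Rightarrow> 'a::discrete_topology) \<times> (nat \<Rightarrow> 'b::discrete_topology)) set"
  assumes "open U" "U \<noteq> {}"
  shows "\<not> meager U"
proof
  assume "meager U"
  then obtain \<T> where \<T>: "countable \<T>" "\<forall>T\<in>\<T>. closed T \<and> interior T = {}" "U \<subseteq> \<Union>\<T>"
    unfolding meager_def by (elim exE conjE)
  \<comment> \<open>Inserting the empty set, itself closed and nowhere dense, keeps the enumeration
    meaningful when \<T> is empty.\<close>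
  define T where "T = from_nat_into (insert {} \<T>)"
  have T: "closed (T k)" "interior (T k) = {}" for k
    using from_nat_into[of "insert {} \<T>" k] \<T>(2) by (auto simp: T_def)
  have range_T: "range T = insert {} \<T>"
    using \<T>(1) by (simp add: T_def)
  obtain q0 where "q0 \<in> U"
    using assms(2) by auto
  then obtain n0 where n0: "brick q0 n0 \<subseteq> U"
    using brick_basis[OF assms(1)] by blast
  have extend: "\<exists>t. snd s < snd t \<and> fst t \<in> brick (fst s) (snd s) \<and> brick (fst t) (snd t) \<inter> T k = {}"
    for s :: "((nat \<Rightarrow> 'a) \<times> (nat \<Rightarrow> 'b)) \<times> nat" and k
  proof -
    have "\<not> brick (fst s) (snd s) \<subseteq> T k"
    proof
      assume "brick (fst s) (snd s) \<subseteq> T k"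
      then have "brick (fst s) (snd s) \<subseteq> interior (T k)"
        by (rule interior_maximal[OF _ open_brick])
      then show False
        using T(2)[of k] brick_self[of "fst s" "snd s"] by (simp add: subset_empty)
    qed
    then obtain q where q: "q \<in> brick (fst s) (snd s)" "q \<in> - T k" by auto
    have "open (- T k)"
      by (rule open_Compl[OF T(1)])
    then obtain m where "m \<ge> Suc (snd s)" "brick q m \<subseteq> - T k"
      using brick_basis[of "- T k" q "Suc (snd s)"] q(2) by blast
    then show ?thesis
      using q(1) by (intro exI[of _ "(q, m)"]) auto
  qed
  \<comment> \<open>Shrinking bricks are chosen one after another, the brick of stage
    \<open>Suc k\<close> avoiding \<open>T k\<close>. The clause for \<open>k = 0\<close> carries
    the initial condition.\<close>
  have "\<exists>s. \<forall>k. (k = 0 \<longrightarrow> brick (fst (s k)) (snd (s k)) \<subseteq> U) \<and>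
    (snd (s k) < snd (s (Suc k)) \<and> fst (s (Suc k)) \<in> brick (fst (s k)) (snd (s k)) \<and>
      brick (fst (s (Suc k))) (snd (s (Suc k))) \<inter> T k = {})"
  proof (rule dependent_nat_choice)
    show "\<exists>s. (0::nat) = 0 \<longrightarrow> brick (fst s) (snd s) \<subseteq> U"
      using n0 by (intro exI[of _ "(q0, n0)"]) simp
  next
    fix s :: "((nat \<Rightarrow> 'a) \<times> (nat \<Rightarrow> 'b)) \<times> nat" and k
    show "\<exists>t. (Suc k = 0 \<longrightarrow> brick (fst t) (snd t) \<subseteq> U) \<and>
        snd s < snd t \<and> fst t \<in> brick (fst s) (snd s) \<and> brick (fst t) (snd t) \<inter> T k = {}"
      using extend[of s k] by simp
  qed
  then obtain s where s: "\<forall>k. (k = 0 \<longrightarrow> brick (fst (s k)) (snd (s k)) \<subseteq> U) \<and>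
    (snd (s k) < snd (s (Suc k)) \<and> fst (s (Suc k)) \<in> brick (fst (s k)) (snd (s k)) \<and>
      brick (fst (s (Suc k))) (snd (s (Suc k))) \<inter> T k = {})" ..
  have s0: "brick (fst (s 0)) (snd (s 0)) \<subseteq> U"
    and less: "snd (s k) < snd (s (Suc k))"
    and step: "fst (s (Suc k)) \<in> brick (fst (s k)) (snd (s k))"
    and avoid: "brick (fst (s (Suc k))) (snd (s (Suc k))) \<inter> T k = {}" for k
    using s by simp_all
  define p n where "p k = fst (s k)" and "n k = snd (s k)" for k
  have n_ge: "k \<le> n k" for k
  proof (induction k)
    case (Suc k)
    then show ?case using less[of k] by (simp add: n_def)
  qed simp
  have n_mono: "n k \<le> n (Suc k)" for k
    using less[of k] by (simp add: n_def)
  have agree: "fst (p l) i = fst (p k) i \<and> snd (p l) i = snd (p k) i" if "k \<le> l" "i < n k" for k l i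
    using that(1)
  proof (induction l rule: dec_induct)
    case IH: (step l)
    have "n k \<le> n l"
      using n_mono IH.hyps(1) by (rule lift_Suc_mono_le)
    then show ?case
      using IH.IH step[of l] that(2)
      by (simp add: brick_def cylinder_def mem_Times_iff p_def n_def)
  qed simp
  \<comment> \<open>The limit is read off diagonally: coordinate \<open>i\<close> is settled by
    stage \<open>Suc i\<close>, whose brick fixes more than \<open>i\<close> entries.\<close>
  define q where "q = (\<lambda>i. fst (p (Suc i)) i, \<lambda>i. snd (p (Suc i)) i)"
  have q: "q \<in> brick (p k) (n k)" for k
  proof -
    have "fst (p (Suc i)) i = fst (p k) i \<and> snd (p (Suc i)) i = snd (p k) i" if "i < n k" for i
    proof (cases "k \<le> Suc i")
      case True
      then show ?thesis using agree[OF True that] by simp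
    next
      case False
      then have "Suc i \<le> k" by simp
      from agree[OF this, of i] n_ge[of "Suc i"] show ?thesis by simp
    qed
    then show ?thesis
      by (simp add: q_def brick_def cylinder_def)
  qed
  have "q \<notin> T k" for k
    using q[of "Suc k"] avoid[of k] by (auto simp: p_def n_def)
  then have "q \<notin> \<Union>\<T>"
    using range_T by (metis UnionE insertCI rangeE)
  moreover have "q \<in> U"
    using q[of 0] s0 by (auto simp: p_def n_def)
  ultimately show False
    using \<T>(3) by auto
qed

lemma not_meager_diff:
  fixes U :: "((nat \<Rightarrow> 'a::discrete_topology) \<times> (nat \<Rightarrow> 'b::discrete_topology)) set"
  assumes "open U" "U \<noteq> {}" "meager S"
  shows "\<exists>p\<in>U. p \<notin> S"
  using baire_sequences[OF assms(1,2)] meager_subset[OF assms(3), of U] by auto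

section \<open>Transfer of comeagerness\<close>

text \<open>
  The witnesses turn the set of rich streams, which is only \<open>G\<^sub>\<delta>\<close>, into a closed set of pairs
  \<open>(a, witness a)\<close>. Showing them in \<open>point\<close> is what makes the graph below locally closed. On streams
  that are not rich, \<open>witness\<close> may be junk.
\<close>

definition witness :: "(nat \<Rightarrow> nat) \<Rightarrow> nat \<Rightarrow> nat" where
  "witness a q = (case from_nat q of (j, c, m) \<Rightarrow> LEAST k. m \<le> k \<and> parent k = j \<and> a k = c)"

text \<open>The search for the least witness reads a stream only up to the position it finds.
  Richness is assumed of \<open>a\<close> alone, so that it can be passed on to a limit
  \<open>b\<close>.\<close>

lemma witness_agree:
  assumes "rich a" and "\<And>i. i \<le> witness a q \<Longrightarrow> b i = a i" and q: "from_nat q = (j, c, m)"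
  shows "witness b q = witness a q" and "\<exists>k\<ge>m. parent k = j \<and> b k = c"
proof -
  let ?P = "\<lambda>a k. m \<le> k \<and> parent k = j \<and> a k = c"
  have w: "witness a q = (LEAST k. ?P a k)" for a
    by (simp add: witness_def q)
  have "\<exists>k. ?P a k"
    using assms(1) by (auto simp: rich_def)
  then have "?P a (witness a q)"
    unfolding w by (rule LeastI_ex)
  then have P: "?P b (witness a q)"
    using assms(2)[of "witness a q"] by simp
  then show "\<exists>k\<ge>m. parent k = j \<and> b k = c"
    by blast
  have "witness a q \<le> k" if "?P b k" for k
  proof (rule ccontr)
    assume "\<not> witness a q \<le> k"
    then have "?P a k"
      using that assms(2)[of k] by simp
    then show False
      using not_less_Least[of k "?P a"] \<open>\<not> witness a q \<le> k\<close> by (simp add: w)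
  qed
  then show "witness b q = witness a q"
    unfolding w[of b] using P by (intro Least_equality) auto
qed

lemma witness_local:
  assumes "rich b"
  shows "\<exists>M. \<forall>b'\<in>cylinder b M. \<forall>i<k. b' i = b i \<and> witness b' i = witness b i"
proof (intro exI ballI allI impI)
  let ?M = "Suc (k + (\<Sum>i<k. witness b i))"
  fix b' i assume b': "b' \<in> cylinder b ?M" and "i < k"
  obtain j c m where q: "from_nat i = (j :: nat, c :: nat, m :: nat)"
    by (cases "from_nat i :: nat \<times> nat \<times> nat") auto
  have "witness b i \<le> (\<Sum>i<k. witness b i)"
    using \<open>i < k\<close> by (intro member_le_sum) auto
  then have "b' l = b l" if "l \<le> witness b i" for l
    using b' that by (simp add: cylinder_def)
  then have "witness b' i = witness b i"
    by (rule witness_agree(1)[OF assms _ q])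
  moreover have "b' i = b i"
    using b' \<open>i < k\<close> by (simp add: cylinder_def)
  ultimately show "b' i = b i \<and> witness b' i = witness b i" by simp
qed

text \<open>Missing a given triple is a closed condition, and it is nowhere dense: a cylinder
  restricts finitely many entries, while node \<open>j\<close> has children arbitrarily far out at
  which \<open>c\<close> can still be placed.\<close>

lemma meager_not_rich: "meager {a. \<not> rich a}"
proof -
  define T where "T = (\<lambda>(j, c, m). {a :: nat \<Rightarrow> nat. \<forall>k\<ge>m. parent k = j \<longrightarrow> a k \<noteq> c})"
  have "meager (T (j, c, m))" for j c m
  proof (rule meager_nowhere_dense)
    have "T (j, c, m) = - (\<Union>k\<in>{k. m \<le> k \<and> parent k = j}. (\<lambda>a. a k) -` {c})"
      by (auto simp: T_def)
    moreover have "open ((\<lambda>a :: nat \<Rightarrow> nat. a k) -` {c})" for k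
      by (intro open_vimage) (auto simp: open_discrete)
    ultimately show "closed (T (j, c, m))"
      by (auto simp: closed_def)
    show "interior (T (j, c, m)) = {}"
    proof (rule ccontr)
      assume "interior (T (j, c, m)) \<noteq> {}"
      then obtain a where "a \<in> interior (T (j, c, m))" by auto
      then obtain n where n: "cylinder a n \<subseteq> interior (T (j, c, m))"
        using cylinder_basis[OF open_interior] by blast
      define k where "k = prod_encode (j, max n m)"
      have k: "max n m \<le> k" "parent k = j"
        by (auto simp: k_def parent_def intro: order_trans[OF _ le_prod_encode_2])
      have "a(k := c) \<in> cylinder a n"
        using k by (simp add: cylinder_def)
      then have "a(k := c) \<in> T (j, c, m)"
        using n interior_subset by blast
      then show False
        using k by (auto simp: T_def)
    qed
  qed
  then have "meager (\<Union>q\<in>UNIV. T q)"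
    by (intro meager_UN) auto
  then show ?thesis
    by (rule meager_subset) (auto simp: T_def rich_def)
qed

lemma meager_not_rich_fst: "meager {p :: (nat \<Rightarrow> nat) \<times> 'b::topological_space. \<not> rich (fst p)}"
proof -
  have "interior (fst ` U) \<noteq> {}" if "open U" "U \<noteq> {}" for U :: "((nat \<Rightarrow> nat) \<times> 'b) set"
    using that interior_open[OF open_image_fst[OF that(1)]] by simp
  from meager_vimage[OF continuous_on_fst[OF continuous_on_id] this meager_not_rich]
  show ?thesis by (simp add: vimage_def)
qed

lemma meager_not_rich_snd: "meager {p :: 'a::topological_space \<times> (nat \<Rightarrow> nat). \<not> rich (snd p)}"
proof -
  have "interior (snd ` U) \<noteq> {}" if "open U" "U \<noteq> {}" for U :: "('a \<times> (nat \<Rightarrow> nat)) set"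
    using that interior_open[OF open_image_snd[OF that(1)]] by simp
  from meager_vimage[OF continuous_on_snd[OF continuous_on_id] this meager_not_rich]
  show ?thesis by (simp add: vimage_def)
qed

section \<open>Points built from a labelling and a shown stream\<close>

definition point :: "label \<Rightarrow> (nat \<Rightarrow> nat) \<times> (nat \<Rightarrow> nat) \<Rightarrow> nat \<Rightarrow> nat" where
  "point \<kappa> p k = to_nat (view \<kappa> (fst p) k, snd p k, witness (snd p) k)"

text \<open>Views read finitely many entries and, at a rich stream, so do witnesses; this is
  continuity at \<open>p\<close>.\<close>

lemma point_local:
  assumes "rich (snd p)"
  shows "\<exists>M. \<forall>q\<in>brick p M. point \<kappa> q \<in> cylinder (point \<kappa> p) k"
proof -
  obtain M where M: "\<forall>b'\<in>cylinder (snd p) M. \<forall>i<k. b' i = snd p i \<and> witness b' i = witness (snd p) i"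
    using witness_local[OF assms] by blast
  have "point \<kappa> q \<in> cylinder (point \<kappa> p) k" if q: "q \<in> brick p (max k M)" for q
  proof -
    have "view \<kappa> (fst q) i = view \<kappa> (fst p) i" if "i < k" for i
      using q that by (intro view_cong[of k]) (auto simp: brick_def cylinder_def mem_Times_iff)
    moreover have "snd q \<in> cylinder (snd p) M"
      using q by (auto simp: brick_def cylinder_def mem_Times_iff)
    ultimately have "point \<kappa> q i = point \<kappa> p i" if "i < k" for i
      using bspec[OF M, of "snd q"] that by (simp add: point_def)
    then show ?thesis
      by (simp add: cylinder_def)
  qed
  then show ?thesis by blast
qed

text \<open>\<open>point\<close> is continuous at pairs with rich second component, and the
  remaining pairs are meager. So either a brick inside \<open>V\<close> is mapped into
  \<open>U\<close>, or almost nothing of \<open>V\<close> is.\<close>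

lemma baire_property_point_open:
  assumes "open U"
  shows "baire_property (point \<kappa> -` U)"
  unfolding baire_property_def
proof (intro allI impI)
  fix V :: "((nat \<Rightarrow> nat) \<times> (nat \<Rightarrow> nat)) set" assume V: "open V \<and> V \<noteq> {}"
  show "\<exists>W. open W \<and> W \<noteq> {} \<and> W \<subseteq> V \<and> (meager (W \<inter> point \<kappa> -` U) \<or> meager (W - point \<kappa> -` U))"
  proof (cases "\<exists>p\<in>V. rich (snd p) \<and> point \<kappa> p \<in> U")
    case True
    then obtain p where p: "p \<in> V" "rich (snd p)" "point \<kappa> p \<in> U" by blast
    obtain k where k: "cylinder (point \<kappa> p) k \<subseteq> U"
      using cylinder_basis[OF assms p(3)] by blast
    obtain M where "\<forall>q\<in>brick p M. point \<kappa> q \<in> cylinder (point \<kappa> p) k"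
      using point_local[OF p(2)] by blast
    then have M: "brick p M \<subseteq> point \<kappa> -` U"
      using k by auto
    obtain N where N: "M \<le> N" "brick p N \<subseteq> V"
      using brick_basis[of V p M] V p(1) by blast
    have "brick p N - point \<kappa> -` U = {}"
      using M brick_mono[OF N(1), of p] by auto
    then have "meager (brick p N - point \<kappa> -` U)"
      by (simp only:) (rule meager_nowhere_dense; simp)
    moreover have "brick p N \<noteq> {}"
      by (metis brick_self empty_iff)
    ultimately show ?thesis
      using N(2) by (intro exI[of _ "brick p N"] conjI disjI2 open_brick)
  next
    case False
    have "meager (V \<inter> point \<kappa> -` U)"
      using meager_not_rich_snd by (rule meager_subset) (use False in auto)
    then show ?thesis
      using V by (intro exI[of _ V]) simp
  qed
qed

lemma baire_property_point:
  assumes "boldSigma \<eta> S"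
  shows "baire_property (point \<kappa> -` S)"
  using assms
proof induction
  case (1 U)
  then show ?case by (rule baire_property_point_open)
next
  case (2 \<eta> \<xi> A)
  have "baire_property (point \<kappa> -` A n)" for n
    using baire_property_Compl[of "point \<kappa> -` (- A n)"] 2[of n] by (simp add: vimage_Compl)
  then show ?case
    using baire_property_UN[of "\<lambda>n. point \<kappa> -` A n"] by (simp add: vimage_UN)
qed

text \<open>
  The back-and-forth step: a condition on which a \<open>\<^bold>\<Pi>\<^sup>0\<^sub>\<zeta>\<close> piece of \<open>S\<close> is comeager is answered by a
  \<open>\<zeta>\<close>-close condition on the other side, where that piece is comeager by induction.
\<close>

lemma meager_transfer:
  assumes "boldSigma \<eta> S" "close \<eta> \<kappa> \<mu> n a a'" "open V"
    and "meager ((cylinder a n \<times> V) \<inter> point \<kappa> -` S)"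
  shows "meager ((cylinder a' n \<times> V) \<inter> point \<mu> -` S)"
  using assms
proof (induction arbitrary: \<kappa> \<mu> n a a' V)
  case (1 U)
  show ?case
  proof (rule ccontr)
    assume *: "\<not> meager ((cylinder a' n \<times> V) \<inter> point \<mu> -` U)"
    have "\<exists>p\<in>(cylinder a' n \<times> V) \<inter> point \<mu> -` U. rich (snd p)"
    proof (rule ccontr)
      assume "\<not> ?thesis"
      then have "meager ((cylinder a' n \<times> V) \<inter> point \<mu> -` U)"
        by (intro meager_subset[OF meager_not_rich_snd]) auto
      then show False using * by simp
    qed
    then obtain x y where x: "x \<in> cylinder a' n" and y: "y \<in> V" "rich y" and xy: "point \<mu> (x, y) \<in> U"
      by auto
    obtain k where k: "cylinder (point \<mu> (x, y)) k \<subseteq> U"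
      using cylinder_basis[OF \<open>open U\<close> xy] by blast
    obtain M where M: "\<forall>y'\<in>cylinder y M. \<forall>i<k. y' i = y i \<and> witness y' i = witness y i"
      using witness_local[OF y(2)] by blast
    have "close 1 \<kappa> \<mu> n a x"
      using \<open>close 1 \<kappa> \<mu> n a a'\<close> by (rule close_cong) (use x in \<open>simp_all add: cylinder_def\<close>)
    then have "close 1 \<mu> \<kappa> n x a"
      by (rule close_sym)
    moreover have "(0 :: countable_ordinal) < 1"
      by (simp add: less_le)
    \<comment> \<open>An open set is entered after seeing finitely many entries of the point, so
      only views have to be matched, and level 0 suffices.\<close>
    ultimately obtain b where b: "\<forall>i<n. b i = a i" "close 0 \<mu> \<kappa> (max n k) x b"
      using close_extend_less[of 1 \<mu> \<kappa> n x a 0 "max n k"] by (meson max.cobounded1)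
    let ?W = "cylinder b (max n k) \<times> (cylinder y M \<inter> V)"
    have "?W \<subseteq> (cylinder a n \<times> V) \<inter> point \<kappa> -` U"
    proof (rule subsetI, clarify)
      fix b' y' assume b': "b' \<in> cylinder b (max n k)" and y': "y' \<in> cylinder y M" "y' \<in> V"
      have "view \<kappa> b' i = view \<mu> x i" if "i < k" for i
      proof -
        have "view \<kappa> b' i = view \<kappa> b i"
          using b' that by (intro view_cong[of "max n k"]) (simp_all add: cylinder_def)
        then show ?thesis
          using b(2) that by (simp add: close_def)
      qed
      then have "point \<kappa> (b', y') i = point \<mu> (x, y) i" if "i < k" for i
        using bspec[OF M y'(1)] that by (simp add: point_def)
      then have "point \<kappa> (b', y') \<in> cylinder (point \<mu> (x, y)) k"
        by (simp add: cylinder_def)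
      moreover have "b' \<in> cylinder a n"
        using b' b(1) by (simp add: cylinder_def)
      ultimately show "(b', y') \<in> (cylinder a n \<times> V) \<inter> point \<kappa> -` U"
        using k y'(2) by auto
    qed
    then have "meager ?W"
      by (rule meager_subset[OF "1.prems"(3)])
    moreover have "open ?W"
      using \<open>open V\<close> by (intro open_Times open_Int open_cylinder)
    moreover have "(b, y) \<in> ?W"
      using y(1) by simp
    ultimately show False
      using baire_sequences[of ?W] by (metis empty_iff)
  qed
next
  case (2 \<eta> \<xi> A)
  show ?case
  proof (rule ccontr)
    let ?B = "cylinder a' n \<times> V"
    assume *: "\<not> meager (?B \<inter> point \<mu> -` (\<Union>i. A i))"
    have "\<exists>i. \<not> meager (?B \<inter> point \<mu> -` A i)"
    proof (rule ccontr)
      assume "\<not> ?thesis"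
      then have "meager (\<Union>i. ?B \<inter> point \<mu> -` A i)"
        by (intro meager_UN) auto
      then show False using * by (simp add: vimage_UN)
    qed
    then obtain i where i: "\<not> meager (?B \<inter> point \<mu> -` A i)" by blast
    have \<eta>: "\<eta> i < \<xi>" "boldSigma (\<eta> i) (- A i)"
      using 2(1)[of i] by simp_all
    have "baire_property (point \<mu> -` A i)"
      using baire_property_Compl[OF baire_property_point[OF \<eta>(2), of \<mu>]] by (simp add: vimage_Compl)
    moreover have "open ?B"
      using \<open>open V\<close> by (intro open_Times open_cylinder)
    ultimately obtain W where W: "open W" "W \<noteq> {}" "W \<subseteq> ?B" "meager (W - point \<mu> -` A i)"
      using baire_property_nonmeager[OF _ _ i] by blast
    obtain p where "p \<in> W" using W(2) by auto
    then obtain K where K: "n \<le> K" "brick p K \<subseteq> W"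
      using brick_basis[OF W(1)] by blast
    let ?V = "cylinder (snd p) K"
    have p: "fst p \<in> cylinder a' n"
      using \<open>p \<in> W\<close> W(3) by auto
    have V: "?V \<subseteq> V"
    proof
      fix y assume "y \<in> ?V"
      then have "(fst p, y) \<in> brick p K" by (simp add: brick_def)
      then show "y \<in> V" using K(2) W(3) by auto
    qed
    have "close \<xi> \<kappa> \<mu> n a (fst p)"
      using \<open>close \<xi> \<kappa> \<mu> n a a'\<close> by (rule close_cong) (use p in \<open>simp_all add: cylinder_def\<close>)
    then have "close \<xi> \<mu> \<kappa> n (fst p) a"
      by (rule close_sym)
    then obtain b where b: "\<forall>i<n. b i = a i" "close (\<eta> i) \<mu> \<kappa> K (fst p) b"
      using close_extend_less[OF _ \<eta>(1) K(1)] by blast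
    have "meager ((cylinder (fst p) K \<times> ?V) \<inter> point \<mu> -` (- A i))"
      using W(4) by (rule meager_subset) (use K(2) in \<open>auto simp: brick_def\<close>)
    \<comment> \<open>The induction hypothesis for the complement of \<open>A i\<close> is applied
      in the opposite direction, from \<mu> to \<kappa>.\<close>
    then have "meager ((cylinder b K \<times> ?V) \<inter> point \<kappa> -` (- A i))"
      using 2(1)[THEN conjunct2, THEN conjunct2, THEN conjunct2, rule_format, OF b(2) open_cylinder]
      by simp
    moreover have "cylinder b K \<subseteq> cylinder a n"
      using b(1) K(1) by (intro cylinder_subset) (simp_all add: cylinder_def)
    then have "meager ((cylinder b K \<times> ?V) \<inter> point \<kappa> -` A i)"
      using V by (intro meager_subset[OF "2.prems"(3)]) auto
    \<comment> \<open>On the answering brick both \<open>A i\<close> and its complement are now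
      meager, against the Baire category theorem.\<close>
    ultimately have "meager (((cylinder b K \<times> ?V) \<inter> point \<kappa> -` (- A i)) \<union>
        ((cylinder b K \<times> ?V) \<inter> point \<kappa> -` A i))"
      by (rule meager_Un)
    then have "meager (cylinder b K \<times> ?V)"
      by (rule meager_subset) auto
    moreover have "open (cylinder b K \<times> ?V)"
      by (intro open_Times open_cylinder)
    moreover have "(b, snd p) \<in> cylinder b K \<times> ?V"
      by simp
    ultimately show False
      using baire_sequences[of "cylinder b K \<times> ?V"] by (metis empty_iff)
  qed
qed

section \<open>The graph\<close>

definition splice :: "(nat \<Rightarrow> 'a) \<Rightarrow> nat \<Rightarrow> (nat \<Rightarrow> 'a) \<Rightarrow> nat \<Rightarrow> 'a" where
  "splice t n a k = (if k < n then t k else a k)"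

lemma rich_splice: "rich a \<Longrightarrow> rich (splice t n a)"
  by (rule rich_cong[of n a]) (auto simp: splice_def)

lemma splice_in_cylinder: "splice t n a \<in> cylinder t n"
  by (simp add: cylinder_def splice_def)

text \<open>Overwriting loses only the first \<open>n\<close> entries, so it maps a brick of length
  at least \<open>n\<close> onto a brick. A preimage is found by restoring the entries of
  \<open>p\<close>.\<close>

lemma meager_vimage_splice:
  fixes S :: "((nat \<Rightarrow> 'a::discrete_topology) \<times> (nat \<Rightarrow> 'b::discrete_topology)) set"
  assumes "meager S"
  shows "meager ((\<lambda>p. (splice t n (fst p), snd p)) -` S)"
proof (rule meager_vimage[OF _ _ assms])
  let ?h = "\<lambda>p :: (nat \<Rightarrow> 'a) \<times> (nat \<Rightarrow> 'b). (splice t n (fst p), snd p)"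
  have "continuous_on UNIV (\<lambda>a. splice t n a k)" for k
  proof (cases "k < n")
    case True
    then show ?thesis by (simp add: splice_def)
  next
    case False
    then show ?thesis by (simp add: splice_def)
  qed
  then have "continuous_on UNIV (splice t n)"
    by (rule continuous_on_coordinatewise_then_product)
  then have "continuous_on UNIV (\<lambda>p :: (nat \<Rightarrow> 'a) \<times> (nat \<Rightarrow> 'b). splice t n (fst p))"
    by (rule continuous_on_compose2[OF _ continuous_on_fst[OF continuous_on_id]]) simp
  then show "continuous_on UNIV ?h"
    by (intro continuous_on_Pair continuous_on_snd continuous_on_id)
  fix U :: "((nat \<Rightarrow> 'a) \<times> (nat \<Rightarrow> 'b)) set"
  assume "open U" "U \<noteq> {}"
  then obtain p where "p \<in> U" by auto
  then obtain m where m: "n \<le> m" "brick p m \<subseteq> U"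
    using brick_basis[OF \<open>open U\<close>] by blast
  have "brick (?h p) m \<subseteq> ?h ` U"
  proof
    fix q assume q: "q \<in> brick (?h p) m"
    have *: "fst q k = t k" if "k < n" for k
      using q m(1) that by (simp add: brick_def cylinder_def splice_def mem_Times_iff)
    have "fst q k = fst p k" if "\<not> k < n" "k < m" for k
      using q that by (simp add: brick_def cylinder_def splice_def mem_Times_iff)
    then have "(splice (fst p) n (fst q), snd q) \<in> brick p m"
      using q by (simp add: brick_def cylinder_def splice_def mem_Times_iff)
    then have "(splice (fst p) n (fst q), snd q) \<in> U"
      using m(2) by blast
    moreover have "splice t n (splice (fst p) n (fst q)) = fst q"
      using * by (auto simp: splice_def)
    then have "q = ?h (splice (fst p) n (fst q), snd q)"
      by simp
    ultimately show "q \<in> ?h ` U" by (rule rev_image_eqI)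
  qed
  then have "brick (?h p) m \<subseteq> interior (?h ` U)"
    by (rule interior_maximal[OF _ open_brick])
  then show "interior (?h ` U) \<noteq> {}"
    by (metis brick_self empty_iff subsetD)
qed

lemma meager_vimage_swap:
  fixes S :: "('a::topological_space \<times> 'b::topological_space) set"
  assumes "meager S"
  shows "meager (prod.swap -` S)"
proof (rule meager_vimage[OF _ _ assms])
  show "continuous_on UNIV (prod.swap :: 'b \<times> 'a \<Rightarrow> 'a \<times> 'b)"
    by (rule continuous_on_swap)
  fix U :: "('b \<times> 'a) set" assume U: "open U" "U \<noteq> {}"
  have "prod.swap ` U = prod.swap -` U"
    by force
  then have "open (prod.swap ` U)"
    using U(1) open_vimage[OF _ continuous_on_swap] by metis
  then show "interior (prod.swap ` U) \<noteq> {}"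
    using U(2) by (simp add: interior_open)
qed

section \<open>Coding of finite conditions and root labels\<close>

text \<open>Truncation by \<open>take n\<close> bounds the length by the code; the second component
  of the decoded pair is padding that makes codes of a given list arbitrarily large.\<close>

definition prefix :: "nat \<Rightarrow> nat list" where
  "prefix n = take n (from_nat (fst (prod_decode n)))"

lemma length_prefix_le: "length (prefix n) \<le> n"
  by (simp add: prefix_def)

lemma prefix_surj: "\<exists>n\<ge>m. prefix n = l"
proof -
  let ?n = "prod_encode (to_nat l, max m (length l))"
  have "max m (length l) \<le> ?n"
    by (rule le_prod_encode_2)
  then show ?thesis
    by (intro exI[of _ ?n]) (simp add: prefix_def)
qed

text \<open>Doubling \<open>n\<close> keeps the two sides \<open>e = 0\<close> and
  \<open>e = 1\<close> apart for all \<open>n\<close>. The label also exceeds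
  \<open>Label \<xi> (1 + n)\<close>, which leaves room to answer a condition of length at most
  \<open>n\<close>.\<close>

definition root_label :: "countable_ordinal \<Rightarrow> nat \<Rightarrow> nat \<Rightarrow> label" where
  "root_label \<xi> n e = Label \<xi> (2 * n + 2 + e)"

lemma root_label_not_bottom: "root_label \<xi> n e \<noteq> bottom"
  by (simp add: root_label_def bottom_def)

lemma root_label_inject: "e < 2 \<Longrightarrow> e' < 2 \<Longrightarrow> root_label \<xi> n e = root_label \<xi> n' e' \<longleftrightarrow> n = n' \<and> e = e'"
  by (auto simp: root_label_def; presburger)

definition start :: "countable_ordinal \<Rightarrow> nat \<Rightarrow> nat \<Rightarrow> nat \<Rightarrow> nat" where
  "start \<xi> n e = (SOME t. close \<xi> (Label \<xi> 1) (root_label \<xi> n e) (length (prefix n)) ((!) (prefix n)) t)"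

text \<open>The answer is built from length 0, where only the two root labels have to be
  compared.\<close>

lemma close_start: "close \<xi> (Label \<xi> 1) (root_label \<xi> n e) (length (prefix n)) ((!) (prefix n)) (start \<xi> n e)"
proof -
  have "\<exists>t. (\<forall>i<0. t i = (!) (prefix n) i) \<and>
    close \<xi> (Label \<xi> 1) (root_label \<xi> n e) (length (prefix n)) ((!) (prefix n)) t"
    using length_prefix_le[of n] by (intro close_extend) (auto simp: root_label_def)
  then show ?thesis
    unfolding start_def by (intro someI_ex[of "close \<xi> _ _ _ _"]) blast
qed

text \<open>
  As \<open>length (prefix n) \<le> n\<close>, the overwritten part of \<open>a\<close> can be read off from \<open>b\<close> when \<open>a\<close> and \<open>b\<close>
  first differ at \<open>n\<close>.
\<close>

definition endpoint :: "countable_ordinal \<Rightarrow> nat \<Rightarrow> nat \<Rightarrow> (nat \<Rightarrow> nat) \<Rightarrow> (nat \<Rightarrow> nat) \<Rightarrow> nat \<Rightarrow> nat" where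
  "endpoint \<xi> n e a b = point (root_label \<xi> n e) (splice (start \<xi> n e) (length (prefix n)) a, b)"

text \<open>\<open>b\<close> is shown outright. By \<open>view_inj\<close> the view gives the root
  label, hence \<open>n\<close> and \<open>e\<close>, and the overwritten stream; the entries of
  \<open>a\<close> lost to overwriting lie below \<open>n\<close>, where \<open>a\<close> agrees
  with \<open>b\<close>.\<close>

lemma endpoint_inject:
  assumes eq: "endpoint \<xi> n e a b = endpoint \<xi> n' e' a' b'"
    and "rich a" "rich a'" "e < 2" "e' < 2"
    and ab: "\<And>i. i < n \<Longrightarrow> a i = b i" and ab': "\<And>i. i < n' \<Longrightarrow> a' i = b' i"
  shows "n = n' \<and> e = e' \<and> a = a' \<and> b = b'"
proof -
  let ?a = "splice (start \<xi> n e) (length (prefix n)) a"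
  let ?a' = "splice (start \<xi> n' e') (length (prefix n')) a'"
  have "view (root_label \<xi> n e) ?a k = view (root_label \<xi> n' e') ?a' k \<and> b k = b' k" for k
    using fun_cong[OF eq, of k] by (simp add: endpoint_def point_def)
  then have "view (root_label \<xi> n e) ?a = view (root_label \<xi> n' e') ?a'" and b: "b = b'"
    by auto
  then have *: "root_label \<xi> n e = root_label \<xi> n' e'" "?a = ?a'"
    using view_inj[OF rich_splice rich_splice _ root_label_not_bottom root_label_not_bottom] assms(2,3) by blast+
  from *(1) have ne: "n = n'" "e = e'"
    using root_label_inject assms(4,5) by blast+
  have "a k = a' k" for k
  proof (cases "k < length (prefix n)")
    case True
    then have "k < n" using length_prefix_le[of n] by simp
    then show ?thesis using ab ab' ne b by simp
  next
    case False
    then show ?thesis using fun_cong[OF *(2), of k] by (simp add: splice_def ne)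
  qed
  then show ?thesis using ne b by auto
qed

section \<open>The edges as a partial injection\<close>

definition splits_at :: "(nat \<Rightarrow> 'a) \<Rightarrow> (nat \<Rightarrow> 'a) \<Rightarrow> nat \<Rightarrow> bool" where
  "splits_at a b n \<longleftrightarrow> (\<forall>i<n. a i = b i) \<and> a n \<noteq> b n"

definition edges :: "countable_ordinal \<Rightarrow> ((nat \<Rightarrow> nat) \<times> (nat \<Rightarrow> nat)) set" where
  "edges \<xi> = {(endpoint \<xi> n 0 a b, endpoint \<xi> n 1 b a) | n a b. rich a \<and> rich b \<and> splits_at a b n}"

lemma edgesE:
  assumes "(x, y) \<in> edges \<xi>"
  obtains n a b where "x = endpoint \<xi> n 0 a b" "y = endpoint \<xi> n 1 b a" "rich a" "rich b" "splits_at a b n"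
  using assms unfolding edges_def by blast

lemma edges_functional:
  assumes "(x, y) \<in> edges \<xi>" "(x, y') \<in> edges \<xi>"
  shows "y = y'"
proof -
  obtain n a b where 1: "x = endpoint \<xi> n 0 a b" "y = endpoint \<xi> n 1 b a" "rich a" "splits_at a b n"
    using assms(1) by (rule edgesE)
  obtain n' a' b' where 2: "x = endpoint \<xi> n' 0 a' b'" "y' = endpoint \<xi> n' 1 b' a'" "rich a'" "splits_at a' b' n'"
    using assms(2) by (rule edgesE)
  have "n = n' \<and> (0::nat) = 0 \<and> a = a' \<and> b = b'"
    using 1 2 by (intro endpoint_inject[of \<xi> n 0 a b n' 0 a' b']) (auto simp: splits_at_def)
  then show ?thesis using 1 2 by simp
qed

lemma edges_injective:
  assumes "(x, y) \<in> edges \<xi>" "(x', y) \<in> edges \<xi>"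
  shows "x = x'"
proof -
  obtain n a b where 1: "x = endpoint \<xi> n 0 a b" "y = endpoint \<xi> n 1 b a" "rich b" "splits_at a b n"
    using assms(1) by (rule edgesE)
  obtain n' a' b' where 2: "x' = endpoint \<xi> n' 0 a' b'" "y = endpoint \<xi> n' 1 b' a'" "rich b'" "splits_at a' b' n'"
    using assms(2) by (rule edgesE)
  have "n = n' \<and> (1::nat) = 1 \<and> b = b' \<and> a = a'"
    using 1 2 by (intro endpoint_inject[of \<xi> n 1 b a n' 1 b' a']) (auto simp: splits_at_def)
  then show ?thesis using 1 2 by simp
qed

lemma edges_disjoint:
  assumes "(x, y) \<in> edges \<xi>" "(z, x) \<in> edges \<xi>"
  shows False
proof -
  obtain n a b where 1: "x = endpoint \<xi> n 0 a b" "rich a" "splits_at a b n"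
    using assms(1) by (rule edgesE)
  obtain n' a' b' where 2: "x = endpoint \<xi> n' 1 b' a'" "rich b'" "splits_at a' b' n'"
    using assms(2) by (rule edgesE)
  have "n = n' \<and> (0::nat) = 1 \<and> a = b' \<and> b = a'"
    using 1 2 by (intro endpoint_inject[of \<xi> n 0 a b n' 1 b' a']) (auto simp: splits_at_def)
  then show False by simp
qed

section \<open>The graph as a difference of closed sets\<close>

text \<open>Decoding is total, so arbitrary points show a stream as well; this supplies the
  candidate streams at limits of edges.\<close>

definition shown :: "nat \<Rightarrow> nat" where
  "shown k = fst (snd (from_nat k :: nat \<times> nat \<times> nat))"

lemma shown_endpoint [simp]: "shown (endpoint \<xi> n e a b k) = b k"
  by (simp add: shown_def endpoint_def point_def)

text \<open>The witnesses recorded in \<open>x\<close> are inherited by \<open>b\<close> from nearby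
  rich streams and prove \<open>b\<close> rich. Richness of \<open>a\<close> has to come from the
  other endpoint of an edge, which shows \<open>a\<close>.\<close>

lemma endpoint_limit:
  assumes "\<And>K. \<exists>a' b'. rich b' \<and> a' \<in> cylinder a K \<and> b' \<in> cylinder b K \<and> endpoint \<xi> n e a' b' \<in> cylinder x K"
  shows "rich b \<and> x = endpoint \<xi> n e a b"
proof -
  define w where "w q = snd (snd (from_nat (x q) :: nat \<times> nat \<times> nat))" for q
  have witness: "witness b q = w q \<and> (\<exists>k\<ge>m. parent k = j \<and> b k = c)" if "from_nat q = (j, c, m)" for q j c m
  proof -
    \<comment> \<open>The length covers position \<open>q\<close>, where the witness is recorded,
      and position \<open>w q\<close>, up to which \<open>b\<close> and \<open>b'\<close> must
      agree.\<close>
    obtain a' b' where b': "rich b'" "b' \<in> cylinder b (Suc (max q (w q)))"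
      "endpoint \<xi> n e a' b' \<in> cylinder x (Suc (max q (w q)))"
      using assms by meson
    have "endpoint \<xi> n e a' b' q = x q"
      using b'(3) by (simp add: cylinder_def)
    then have w: "w q = witness b' q"
      unfolding w_def by (simp add: endpoint_def point_def flip: \<open>endpoint \<xi> n e a' b' q = x q\<close>)
    have "b i = b' i" if "i \<le> witness b' q" for i
      using b'(2) that by (simp add: cylinder_def w)
    from witness_agree[OF b'(1) this \<open>from_nat q = (j, c, m)\<close>] show ?thesis
      by (simp add: w)
  qed
  have "rich b"
    unfolding rich_def
  proof (intro allI)
    fix j c m
    show "\<exists>k\<ge>m. parent k = j \<and> b k = c"
      using witness[of "to_nat (j, c, m)" j c m] by simp
  qed
  moreover have "x k = endpoint \<xi> n e a b k" for k
  proof -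
    obtain a' b' where ab': "a' \<in> cylinder a (Suc k)" "b' \<in> cylinder b (Suc k)"
      "endpoint \<xi> n e a' b' \<in> cylinder x (Suc k)"
      using assms by meson
    obtain j c m where "from_nat k = (j :: nat, c :: nat, m :: nat)"
      by (cases "from_nat k :: nat \<times> nat \<times> nat") auto
    then have "witness b k = w k"
      using witness by blast
    moreover have x: "x k = endpoint \<xi> n e a' b' k"
      using ab'(3) by (simp add: cylinder_def)
    ultimately have "witness b k = witness b' k"
      by (simp add: w_def endpoint_def point_def)
    moreover have "view (root_label \<xi> n e) (splice (start \<xi> n e) (length (prefix n)) a') k =
        view (root_label \<xi> n e) (splice (start \<xi> n e) (length (prefix n)) a) k"
      using ab'(1) by (intro view_cong[of "Suc k"]) (auto simp: cylinder_def splice_def)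
    moreover have "b' k = b k"
      using ab'(2) by (simp add: cylinder_def)
    ultimately show ?thesis
      by (simp add: x endpoint_def point_def)
  qed
  ultimately show ?thesis by blast
qed

text \<open>Off the closed set \<open>D\<close> of pairs showing equal streams, the splitting place
  is read off and is locally constant. With \<open>n\<close> fixed, both endpoints pass to limits by
  \<open>endpoint_limit\<close>.\<close>

lemma edges_locally_closed: "\<exists>C D. closed C \<and> closed D \<and> edges \<xi> = C - D"
proof -
  define D where "D = {p :: (nat \<Rightarrow> nat) \<times> (nat \<Rightarrow> nat). \<forall>k. shown (fst p k) = shown (snd p k)}"
  have "open (- D)"
  proof (subst open_subopen, intro ballI)
    fix p assume "p \<in> - D"
    then obtain k where k: "shown (fst p k) \<noteq> shown (snd p k)" by (auto simp: D_def)
    have "brick p (Suc k) \<subseteq> - D"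
    proof
      fix q assume "q \<in> brick p (Suc k)"
      then have "fst q k = fst p k" "snd q k = snd p k"
        by (simp_all add: brick_def cylinder_def mem_Times_iff)
      with k have "shown (fst q k) \<noteq> shown (snd q k)" by simp
      then show "q \<in> - D"
        unfolding D_def by blast
    qed
    then show "\<exists>T. open T \<and> p \<in> T \<and> T \<subseteq> - D"
      by (intro exI[of _ "brick p (Suc k)"]) (simp add: open_brick)
  qed
  then have "closed D" by (simp add: closed_def)
  moreover have "edges \<xi> = closure (edges \<xi>) - D"
  proof
    have "edges \<xi> \<inter> D = {}"
      by (auto simp: edges_def D_def splits_at_def)
    then show "edges \<xi> \<subseteq> closure (edges \<xi>) - D"
      using closure_subset by blast
    show "closure (edges \<xi>) - D \<subseteq> edges \<xi>"
    proof
      fix p assume "p \<in> closure (edges \<xi>) - D"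
      moreover obtain x y where p: "p = (x, y)" by (cases p)
      ultimately have xy: "(x, y) \<in> closure (edges \<xi>)" "(x, y) \<notin> D" by simp_all
      define a b where "a k = shown (y k)" and "b k = shown (x k)" for k
      have "\<exists>k. a k \<noteq> b k"
        using xy(2) unfolding D_def a_def b_def by (simp; metis)
      define n where "n = (LEAST k. a k \<noteq> b k)"
      have n: "splits_at a b n"
        using LeastI_ex[OF \<open>\<exists>k. a k \<noteq> b k\<close>] not_less_Least unfolding splits_at_def n_def by blast
      have approx: "\<exists>a' b'. rich a' \<and> rich b' \<and> a' \<in> cylinder a K \<and> b' \<in> cylinder b K \<and>
          endpoint \<xi> n 0 a' b' \<in> cylinder x K \<and> endpoint \<xi> n 1 b' a' \<in> cylinder y K" for K
      proof -
        \<comment> \<open>Entry \<open>n\<close> has to be seen, so that the approximating edge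
          splits at \<open>n\<close> too.\<close>
        let ?K = "max K (Suc n)"
        have "brick (x, y) ?K \<inter> edges \<xi> \<noteq> {}"
          using xy(1) open_brick brick_self open_Int_closure_eq_empty by (metis disjoint_iff)
        then obtain n' a' b' where e: "rich a'" "rich b'" "splits_at a' b' n'"
          and "(endpoint \<xi> n' 0 a' b', endpoint \<xi> n' 1 b' a') \<in> brick (x, y) ?K"
          unfolding edges_def by blast
        then have in_cyl: "endpoint \<xi> n' 0 a' b' i = x i" "endpoint \<xi> n' 1 b' a' i = y i" if "i < ?K" for i
          using that by (simp_all add: brick_def cylinder_def)
        have ab: "a' i = a i" "b' i = b i" if "i < ?K" for i
          using in_cyl[OF that, THEN arg_cong[of _ _ shown]] by (simp_all add: a_def b_def)
        have "n' = n"
        proof (rule linorder_cases)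
          assume "n' < n"
          then show ?thesis
            using ab[of n'] n e(3) by (simp add: splits_at_def less_max_iff_disj)
        next
          assume "n < n'"
          then show ?thesis
            using ab[of n] n e(3) by (simp add: splits_at_def less_max_iff_disj)
        qed
        then show ?thesis
          using e(1,2) in_cyl ab by (intro exI[of _ a'] exI[of _ b']) (simp add: cylinder_def)
      qed
      have "rich b \<and> x = endpoint \<xi> n 0 a b"
        by (rule endpoint_limit) (use approx in meson)
      moreover have "rich a \<and> y = endpoint \<xi> n 1 b a"
        by (rule endpoint_limit) (use approx in meson)
      ultimately show "p \<in> edges \<xi>"
        using n unfolding edges_def p by blast
    qed
  qed
  ultimately show ?thesis
    using closed_closure by blast
qed

section \<open>Absence of measurable colourings\<close>

lemma edges_not_colorable:
  assumes "boldDelta_measurable \<xi> c"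
  shows "\<not> countable_coloring (edges \<xi>) c"
proof
  assume col: "countable_coloring (edges \<xi>) c"
  let ?C = "\<lambda>j. c -` {j}"
  have Sigma: "boldSigma \<xi> (?C j)" "boldSigma \<xi> (- ?C j)" for j
    using assms by (simp_all add: boldDelta_measurable_def boldDelta_def boldPi_def)
  \<comment> \<open>\<open>Label \<xi> 1\<close> is the least label that \<open>close \<xi>\<close>
    does not tell apart from larger ones, so results for it transfer to all root labels in
    use.\<close>
  let ?p = "point (Label \<xi> 1)"
  have "\<exists>j. \<not> meager (UNIV \<inter> ?p -` ?C j)"
  proof (rule ccontr)
    assume "\<not> ?thesis"
    then have "meager (\<Union>j. UNIV \<inter> ?p -` ?C j)"
      by (intro meager_UN) auto
    moreover have "(\<Union>j. UNIV \<inter> ?p -` ?C j) = UNIV" by auto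
    ultimately show False
      using baire_sequences[of "UNIV :: ((nat \<Rightarrow> nat) \<times> (nat \<Rightarrow> nat)) set"] by simp
  qed
  then obtain j where "\<not> meager (UNIV \<inter> ?p -` ?C j)" ..
  then obtain W where W: "open W" "W \<noteq> {}" "meager (W - ?p -` ?C j)"
    using baire_property_nonmeager[OF baire_property_point[OF Sigma(1)] open_UNIV] by blast
  obtain p where "p \<in> W" using W(2) by auto
  then obtain K where K: "brick p K \<subseteq> W"
    using brick_basis[OF W(1)] by blast
  define y where "y = snd p"
  \<comment> \<open>\<open>n\<close> codes the first \<open>K\<close> entries of the condition,
    while \<open>K \<le> n\<close> lets both streams follow \<open>y\<close> up to \<open>K\<close>
    before they split.\<close>
  obtain n where n: "K \<le> n" "prefix n = map (fst p) [0..<K]"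
    using prefix_surj by blast
  have len: "length (prefix n) = K" by (simp add: n(2))
  have bad: "meager ((cylinder (start \<xi> n e) K \<times> cylinder y K) \<inter> point (root_label \<xi> n e) -` (- ?C j))" for e
  proof (rule meager_transfer[OF Sigma(2) _ open_cylinder])
    show "close \<xi> (Label \<xi> 1) (root_label \<xi> n e) K (fst p) (start \<xi> n e)"
      using close_start[of \<xi> n e] unfolding len by (rule close_cong) (simp_all add: n(2))
    show "meager ((cylinder (fst p) K \<times> cylinder y K) \<inter> ?p -` (- ?C j))"
      using W(3) by (rule meager_subset) (use K in \<open>auto simp: brick_def y_def\<close>)
  qed
  \<comment> \<open>An endpoint is computed from the overwritten stream, so the transferred meager
    set is pulled back along overwriting.\<close>
  define B where "B e = (\<lambda>p. (splice (start \<xi> n e) K (fst p), snd p)) -`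
      ((cylinder (start \<xi> n e) K \<times> cylinder y K) \<inter> point (root_label \<xi> n e) -` (- ?C j))" for e
  have "meager (B e)" for e
    unfolding B_def by (rule meager_vimage_splice[OF bad])
  \<comment> \<open>The endpoint of side 1 views \<open>b\<close> and shows \<open>a\<close>, hence
    the swap.\<close>
  then have "meager (B 0 \<union> prod.swap -` B 1 \<union> ({p. \<not> rich (fst p)} \<union> {p. \<not> rich (snd p)}))"
    by (intro meager_Un meager_vimage_swap meager_not_rich_fst meager_not_rich_snd)
  \<comment> \<open>The values 0 and 1 at \<open>n\<close> force a generic pair to split exactly
    there.\<close>
  moreover have "open (cylinder (y(n := 0)) (Suc n) \<times> cylinder (y(n := 1)) (Suc n))"
    by (intro open_Times open_cylinder)
  moreover have "cylinder (y(n := 0)) (Suc n) \<times> cylinder (y(n := 1)) (Suc n) \<noteq> {}"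
    by (metis SigmaI cylinder_self empty_iff)
  ultimately obtain q where q: "q \<in> cylinder (y(n := 0)) (Suc n) \<times> cylinder (y(n := 1)) (Suc n)"
    "q \<notin> B 0 \<union> prod.swap -` B 1 \<union> ({p. \<not> rich (fst p)} \<union> {p. \<not> rich (snd p)})"
    using not_meager_diff by blast
  obtain a b where ab: "q = (a, b)" by (cases q)
  have a: "a i = (if i < n then y i else 0)" and b: "b i = (if i < n then y i else 1)" if "i \<le> n" for i
    using q(1) that by (auto simp: ab cylinder_def)
  have rich: "rich a" "rich b"
    using q(2) by (auto simp: ab)
  have "splits_at a b n"
    using a b by (simp add: splits_at_def)
  then have "(endpoint \<xi> n 0 a b, endpoint \<xi> n 1 b a) \<in> edges \<xi>"
    using rich unfolding edges_def by blast
  then have neq: "c (endpoint \<xi> n 0 a b) \<noteq> c (endpoint \<xi> n 1 b a)"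
    using col by (auto simp: countable_coloring_def)
  have "a \<in> cylinder y K" "b \<in> cylinder y K"
    using a b n(1) by (simp_all add: cylinder_def)
  moreover have "(a, b) \<notin> B 0" "(b, a) \<notin> B 1"
    using q(2) by (auto simp: ab)
  ultimately have "c (endpoint \<xi> n 0 a b) = j" "c (endpoint \<xi> n 1 b a) = j"
    by (simp_all add: B_def endpoint_def len splice_in_cylinder)
  then show False using neq by simp
qed

theorem theorem1p2:
  fixes \<xi> :: countable_ordinal
  assumes "1 \<le> \<xi>"
  shows "\<exists>i :: (nat \<Rightarrow> nat) \<Rightarrow> (nat \<Rightarrow> nat) option.
    inj_on i (dom i) \<and>
    dom i \<inter> ran i = {} \<and>
    (\<exists>C D. closed C \<and> closed D \<and> Map.graph i = C - D) \<and>
    \<not> (\<exists>c :: (nat \<Rightarrow> nat) \<Rightarrow> nat.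
          boldDelta_measurable \<xi> c \<and> countable_coloring (Map.graph i) c)"
proof -
  define i where "i x = (if \<exists>y. (x, y) \<in> edges \<xi> then Some (THE y. (x, y) \<in> edges \<xi>) else None)" for x
  have i: "i x = Some y \<longleftrightarrow> (x, y) \<in> edges \<xi>" for x y
  proof
    assume "i x = Some y"
    then obtain z where "(x, z) \<in> edges \<xi>" "y = (THE y. (x, y) \<in> edges \<xi>)"
      by (auto simp: i_def split: if_splits)
    then show "(x, y) \<in> edges \<xi>"
      using theI[of "\<lambda>y. (x, y) \<in> edges \<xi>" z] edges_functional by blast
  next
    assume *: "(x, y) \<in> edges \<xi>"
    then have "(THE y. (x, y) \<in> edges \<xi>) = y"
      using edges_functional by blast
    then show "i x = Some y"
      using * by (auto simp: i_def)
  qed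
  then have graph: "Map.graph i = edges \<xi>"
    by (auto simp: Map.graph_def)
  have "inj_on i (dom i)"
  proof (rule inj_onI)
    fix x x' assume "x \<in> dom i" "i x = i x'"
    then obtain y where "i x = Some y" by blast
    moreover from this have "i x' = Some y"
      using \<open>i x = i x'\<close> by simp
    ultimately show "x = x'" using edges_injective i by blast
  qed
  moreover have "dom i \<inter> ran i = {}"
    using edges_disjoint i by (fastforce simp: ran_def dom_def)
  ultimately show ?thesis
    using edges_locally_closed[of \<xi>] edges_not_colorable[of \<xi>] graph by (intro exI[of _ i]) auto
qed

end
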